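(* Let $\mathbb{K}$ be a field of characteristic $0$, let $R$ be a $\mathbb{K}[q^{\pm1}]$-algebra, and let $\epsilon\in\mathbb{K}^\times$ be such that $q-\epsilon\in R$ is regular (not a zero divisor). Assume that the specialization $R_\epsilon:=R/(q-\epsilon)R$ is a free module of finite rank over a Poisson subalgebra $C_\epsilon$ of its center $Z(R_\epsilon)$, where $Z(R_\epsilon)$ carries its canonical Poisson structure $\{\cdot,\cdot\}$ induced by specialization. (i) Then the discriminant $d(R_\epsilon/C_\epsilon)$ is a Poisson normal element of $(C_\epsilon,\{\cdot,\cdot\})$. (ii) Assume, in addition, that $C_\epsilon$ is a unique factorization domain as a commutative algebra or a noetherian Poisson unique factorization domain. Then $d(R_\epsilon/C_\epsilon)=0$ or $$d(R_\epsilon/C_\epsilon)=_{C_\epsilon^\times}\prod_{i=1}^m p_i$$ for some (not necessarily distinct) Poisson prime elements $p_1,\dots,p_m\in C_\epsilon$ (a product of $0$ primes is $1$).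
   Context: All algebras are unital. Let $\sigma:R\to R_\epsilon$ be the projection. Poisson structure on $Z(R_\epsilon)$: for $z_1,z_2\in Z(R_\epsilon)$ choose $x_i\in\sigma^{-1}(z_i)$ and set $\{z_1,z_2\}:=\sigma\big(\tfrac{x_1x_2-x_2x_1}{q-\epsilon}\big)$; this is well defined and makes $Z(R_\epsilon)$ a Poisson algebra. Discriminant: if an algebra $S$ is a free module of rank $N$ over a subalgebra $C$ of its center, left multiplication in a $C$-basis gives an embedding $S\hookrightarrow M_N(C)$, and composing with the matrix trace gives $\mathrm{tr}:S\to C$, independent of the basis. For a $C$-basis $\{y_1,\dots,y_N\}$ of $S$, $d(S/C):=\det\big([\mathrm{tr}(y_iy_j)]_{i,j=1}^N\big)\in C$. It is well defined up to multiplication by units of $C$; $a=_{C^\times}b$ means $a=ub$ for some unit $u\in C^\times$. (Poisson normality is unaffected by multiplication by a unit.) For a commutative Poisson algebra $A$: $a\in A$ is Poisson normal if for every $x\in A$ there is $y\in A$ with $\{a,x\}=ay$ (equivalently, $(a)$ is a Poisson ideal). If $A$ is an integral domain, $p\in A$ is Poisson prime if it is a (nonzero) prime element of the commutative algebra $A$ that is Poisson normal. A noetherian Poisson unique factorization domain is a Poisson algebra that is noetherian and an integral domain as a commutative algebra, and in which every nonzero Poisson prime ideal (prime ideal closed under bracketing with $A$) contains a Poisson prime element. *)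

theory Defs
  imports
    "HOL-Algebra.Algebra"
    "HOL-Algebra.Algebraic_Closure_Type"
    "HOL-Combinatorics.Permutations"
    "HOL-Library.Poly_Mapping"
begin

section \<open>Algebras and centers\<close>

definition ring_center :: "('a, 'm) ring_scheme \<Rightarrow> 'a set" where
  "ring_center S = {z \<in> carrier S. \<forall>s \<in> carrier S. z \<otimes>\<^bsub>S\<^esub> s = s \<otimes>\<^bsub>S\<^esub> z}"

text \<open>
  A unital associative algebra over a commutative ring \<open>'b\<close> is a ring together with a unital ring
  homomorphism from \<open>'b\<close> into its center.
\<close>

definition algebra_over :: "('b::comm_ring_1 \<Rightarrow> 'a) \<Rightarrow> ('a, 'm) ring_scheme \<Rightarrow> bool" where
  "algebra_over h S \<longleftrightarrow>
     ring S \<and> h \<in> ring_hom (ring_of_type_algebra :: 'b ring) S \<and> range h \<subseteq> ring_center S"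

definition regular_element :: "('a, 'm) ring_scheme \<Rightarrow> 'a \<Rightarrow> bool" where
  "regular_element S a \<longleftrightarrow> a \<in> carrier S \<and>
     (\<forall>x \<in> carrier S. (a \<otimes>\<^bsub>S\<^esub> x = \<zero>\<^bsub>S\<^esub> \<longrightarrow> x = \<zero>\<^bsub>S\<^esub>) \<and> (x \<otimes>\<^bsub>S\<^esub> a = \<zero>\<^bsub>S\<^esub> \<longrightarrow> x = \<zero>\<^bsub>S\<^esub>))"

text \<open>
  With convolution as multiplication, \<open>int \<Rightarrow>\<^sub>0 'k\<close> is the group algebra of the integers, that is, the
  Laurent polynomial ring in one variable \<open>q\<close> over \<open>'k\<close>; the monomial \<open>c q\<^sup>n\<close> is
  \<open>Poly_Mapping.single n c\<close>.
\<close>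

type_synonym 'k laurent = "int \<Rightarrow>\<^sub>0 'k"

definition laurent_const :: "'k::comm_ring_1 \<Rightarrow> 'k laurent" where
  "laurent_const c = Poly_Mapping.single 0 c"

definition laurent_q :: "'k::comm_ring_1 laurent" where
  "laurent_q = Poly_Mapping.single 1 1"


section \<open>Specialization at a central element\<close>

text \<open>
  In this section \<open>t\<close> is a central regular element of \<open>R\<close>; it will be the image of \<open>q - \<epsilon>\<close>.
\<close>

definition spec_ideal :: "('a, 'm) ring_scheme \<Rightarrow> 'a \<Rightarrow> 'a set" where
  "spec_ideal R t = {t \<otimes>\<^bsub>R\<^esub> x | x. x \<in> carrier R}"

definition specialization :: "('a, 'm) ring_scheme \<Rightarrow> 'a \<Rightarrow> 'a set ring" where
  "specialization R t = R Quot (spec_ideal R t)"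

definition spec_map :: "('a, 'm) ring_scheme \<Rightarrow> 'a \<Rightarrow> 'a \<Rightarrow> 'a set" where
  "spec_map R t x = spec_ideal R t +>\<^bsub>R\<^esub> x"

definition spec_center :: "('a, 'm) ring_scheme \<Rightarrow> 'a \<Rightarrow> 'a set ring" where
  "spec_center R t = (specialization R t)\<lparr>carrier := ring_center (specialization R t)\<rparr>"

text \<open>
  The unique \<open>y\<close> with \<open>t y = x1 x2 - x2 x1\<close> is the quotient of the commutator by \<open>t\<close>. It exists
  because \<open>z1\<close> and \<open>z2\<close> are central, and its image in the specialization does not depend on the
  choice of the lifts \<open>x1\<close>, \<open>x2\<close>. Outside the center the value is meaningless.
\<close>

definition spec_bracket :: "('a, 'm) ring_scheme \<Rightarrow> 'a \<Rightarrow> 'a set \<Rightarrow> 'a set \<Rightarrow> 'a set" where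
  "spec_bracket R t z1 z2 =
     (let x1 = (SOME x. x \<in> carrier R \<and> spec_map R t x = z1);
          x2 = (SOME x. x \<in> carrier R \<and> spec_map R t x = z2)
      in spec_map R t
           (THE y. y \<in> carrier R \<and> t \<otimes>\<^bsub>R\<^esub> y = x1 \<otimes>\<^bsub>R\<^esub> x2 \<ominus>\<^bsub>R\<^esub> x2 \<otimes>\<^bsub>R\<^esub> x1))"


section \<open>Poisson algebras\<close>

text \<open>The map \<open>k\<close> is the structure map of \<open>A\<close> as an algebra over the ground ring.\<close>

locale poisson_algebra = cring A
  for A :: "('a, 'm) ring_scheme" (structure)
    and k :: "'b::comm_ring_1 \<Rightarrow> 'a"
    and br :: "'a \<Rightarrow> 'a \<Rightarrow> 'a" +
  assumes algebra: "algebra_over k A"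
    and br_closed: "\<lbrakk>x \<in> carrier A; y \<in> carrier A\<rbrakk> \<Longrightarrow> br x y \<in> carrier A"
    and br_add_left: "\<lbrakk>x \<in> carrier A; y \<in> carrier A; z \<in> carrier A\<rbrakk>
          \<Longrightarrow> br (x \<oplus> y) z = br x z \<oplus> br y z"
    and br_add_right: "\<lbrakk>x \<in> carrier A; y \<in> carrier A; z \<in> carrier A\<rbrakk>
          \<Longrightarrow> br x (y \<oplus> z) = br x y \<oplus> br x z"
    and br_scale_left: "\<lbrakk>x \<in> carrier A; y \<in> carrier A\<rbrakk> \<Longrightarrow> br (k c \<otimes> x) y = k c \<otimes> br x y"
    and br_scale_right: "\<lbrakk>x \<in> carrier A; y \<in> carrier A\<rbrakk> \<Longrightarrow> br x (k c \<otimes> y) = k c \<otimes> br x y"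
    and br_self: "x \<in> carrier A \<Longrightarrow> br x x = \<zero>"
    and br_jacobi: "\<lbrakk>x \<in> carrier A; y \<in> carrier A; z \<in> carrier A\<rbrakk>
          \<Longrightarrow> br x (br y z) \<oplus> br y (br z x) \<oplus> br z (br x y) = \<zero>"
    and br_leibniz: "\<lbrakk>x \<in> carrier A; y \<in> carrier A; z \<in> carrier A\<rbrakk>
          \<Longrightarrow> br x (y \<otimes> z) = br x y \<otimes> z \<oplus> y \<otimes> br x z"

definition poisson_subalgebra ::
  "('a, 'm) ring_scheme \<Rightarrow> ('b::comm_ring_1 \<Rightarrow> 'a) \<Rightarrow> ('a \<Rightarrow> 'a \<Rightarrow> 'a) \<Rightarrow> 'a set \<Rightarrow> bool" where
  "poisson_subalgebra A k br C \<longleftrightarrow>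
     subring C A \<and> (\<forall>c. \<forall>x \<in> C. k c \<otimes>\<^bsub>A\<^esub> x \<in> C) \<and> (\<forall>x \<in> C. \<forall>y \<in> C. br x y \<in> C)"

definition poisson_normal :: "('a, 'm) ring_scheme \<Rightarrow> ('a \<Rightarrow> 'a \<Rightarrow> 'a) \<Rightarrow> 'a \<Rightarrow> bool" where
  "poisson_normal A br a \<longleftrightarrow>
     a \<in> carrier A \<and> (\<forall>x \<in> carrier A. \<exists>y \<in> carrier A. br a x = a \<otimes>\<^bsub>A\<^esub> y)"

definition poisson_prime :: "('a, 'm) ring_scheme \<Rightarrow> ('a \<Rightarrow> 'a \<Rightarrow> 'a) \<Rightarrow> 'a \<Rightarrow> bool" where
  "poisson_prime A br p \<longleftrightarrow> p \<in> carrier A \<and> ring_prime\<^bsub>A\<^esub> p \<and> poisson_normal A br p"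

definition poisson_prime_ideal :: "('a, 'm) ring_scheme \<Rightarrow> ('a \<Rightarrow> 'a \<Rightarrow> 'a) \<Rightarrow> 'a set \<Rightarrow> bool" where
  "poisson_prime_ideal A br P \<longleftrightarrow>
     primeideal P A \<and> (\<forall>a \<in> P. \<forall>x \<in> carrier A. br a x \<in> P)"

definition noetherian_poisson_ufd ::
  "('a, 'm) ring_scheme \<Rightarrow> ('b::comm_ring_1 \<Rightarrow> 'a) \<Rightarrow> ('a \<Rightarrow> 'a \<Rightarrow> 'a) \<Rightarrow> bool" where
  "noetherian_poisson_ufd A k br \<longleftrightarrow>
     poisson_algebra A k br \<and> noetherian_domain A \<and>
     (\<forall>P. poisson_prime_ideal A br P \<and> P \<noteq> {\<zero>\<^bsub>A\<^esub>} \<longrightarrow> (\<exists>p \<in> P. poisson_prime A br p))"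


section \<open>Free modules over central subalgebras and the discriminant\<close>

definition module_basis :: "('a, 'm) ring_scheme \<Rightarrow> 'a set \<Rightarrow> nat \<Rightarrow> (nat \<Rightarrow> 'a) \<Rightarrow> bool" where
  "module_basis S C N y \<longleftrightarrow>
     y \<in> {..<N} \<rightarrow> carrier S \<and>
     (\<forall>s \<in> carrier S. \<exists>c \<in> {..<N} \<rightarrow> C. s = (\<Oplus>\<^bsub>S\<^esub>i\<in>{..<N}. c i \<otimes>\<^bsub>S\<^esub> y i)) \<and>
     (\<forall>c \<in> {..<N} \<rightarrow> C. (\<Oplus>\<^bsub>S\<^esub>i\<in>{..<N}. c i \<otimes>\<^bsub>S\<^esub> y i) = \<zero>\<^bsub>S\<^esub> \<longrightarrow> (\<forall>i<N. c i = \<zero>\<^bsub>S\<^esub>))"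

definition basis_coords ::
  "('a, 'm) ring_scheme \<Rightarrow> 'a set \<Rightarrow> nat \<Rightarrow> (nat \<Rightarrow> 'a) \<Rightarrow> 'a \<Rightarrow> nat \<Rightarrow> 'a" where
  "basis_coords S C N y s =
     (THE c. c \<in> {..<N} \<rightarrow>\<^sub>E C \<and> s = (\<Oplus>\<^bsub>S\<^esub>i\<in>{..<N}. c i \<otimes>\<^bsub>S\<^esub> y i))"

definition left_mult_matrix ::
  "('a, 'm) ring_scheme \<Rightarrow> 'a set \<Rightarrow> nat \<Rightarrow> (nat \<Rightarrow> 'a) \<Rightarrow> 'a \<Rightarrow> nat \<Rightarrow> nat \<Rightarrow> 'a" where
  "left_mult_matrix S C N y s i j = basis_coords S C N y (s \<otimes>\<^bsub>S\<^esub> y j) i"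

text \<open>
  The trace does not depend on the basis; below, the same basis \<open>y\<close> serves for the trace and for the
  discriminant.
\<close>

definition algebra_trace ::
  "('a, 'm) ring_scheme \<Rightarrow> 'a set \<Rightarrow> nat \<Rightarrow> (nat \<Rightarrow> 'a) \<Rightarrow> 'a \<Rightarrow> 'a" where
  "algebra_trace S C N y s = (\<Oplus>\<^bsub>S\<lparr>carrier := C\<rparr>\<^esub>i\<in>{..<N}. left_mult_matrix S C N y s i i)"

text \<open>The determinant over the commutative ring \<open>A\<close>, by the Leibniz formula.\<close>

definition ring_det :: "('a, 'm) ring_scheme \<Rightarrow> nat \<Rightarrow> (nat \<Rightarrow> nat \<Rightarrow> 'a) \<Rightarrow> 'a" where
  "ring_det A n M =
     (\<Oplus>\<^bsub>A\<^esub>p\<in>{p. p permutes {..<n}}. add_pow A (sign p) (\<Otimes>\<^bsub>A\<^esub>i\<in>{..<n}. M i (p i)))"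

definition discriminant ::
  "('a, 'm) ring_scheme \<Rightarrow> 'a set \<Rightarrow> nat \<Rightarrow> (nat \<Rightarrow> 'a) \<Rightarrow> 'a" where
  "discriminant S C N y =
     ring_det (S\<lparr>carrier := C\<rparr>) N (\<lambda>i j. algebra_trace S C N y (y i \<otimes>\<^bsub>S\<^esub> y j))"

end

theory Submission
  imports Defs
begin

text \<open>
  For \<open>x \<in> C\<close> the bracket \<open>D = {-, x}\<close> extends to a derivation of the whole specialization \<open>S\<close>: fix a
  lift of \<open>x\<close> and divide commutators with it by \<open>t\<close>. A derivation of \<open>S\<close> preserving \<open>C\<close> commutes with
  the trace, so the Gram matrix \<open>M = (tr (y\<^sub>i y\<^sub>j))\<close> satisfies \<open>D M = b M + (b M)\<^sup>T\<close>, where \<open>b\<close> is the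
  matrix of \<open>D\<close> on the basis, and Jacobi's formula gives \<open>D (det M) = 2 (tr b) (det M)\<close>.

  If \<open>C\<close> is factorial, a prime factor \<open>p\<close> of a Poisson normal element divides \<open>D p\<close>, by applying \<open>D\<close> to
  \<open>p\<^sup>n a\<close> with \<open>p \<nmid> a\<close> and inverting \<open>n\<close>. If \<open>C\<close> is a noetherian Poisson UFD, let \<open>\<Sigma>\<close> be the set of
  products of Poisson primes and a unit. It is closed under multiplication and under divisors. If
  \<open>d \<notin> \<Sigma>\<close>, then a Poisson ideal containing \<open>d\<close> and maximal among those avoiding \<open>\<Sigma>\<close> is radical and
  prime (radicals of Poisson ideals are Poisson in characteristic \<open>0\<close>, and so are the colon ideals of
  radical Poisson ideals); hence it contains a Poisson prime element, a contradiction. This avoids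
  Krull's principal ideal theorem.
\<close>

section \<open>Determinants and derivations\<close>

lemma (in abelian_monoid) finsum_swap:
  assumes "finite I" "finite J" "\<And>i j. i \<in> I \<Longrightarrow> j \<in> J \<Longrightarrow> f i j \<in> carrier G"
  shows "(\<Oplus>i\<in>I. \<Oplus>j\<in>J. f i j) = (\<Oplus>j\<in>J. \<Oplus>i\<in>I. f i j)"
  using assms
proof (induction I rule: finite_induct)
  case empty
  then show ?case by (simp add: finsum_zero)
next
  case (insert x I)
  have "(\<Oplus>i\<in>insert x I. \<Oplus>j\<in>J. f i j) = (\<Oplus>j\<in>J. f x j) \<oplus> (\<Oplus>i\<in>I. \<Oplus>j\<in>J. f i j)"
    using insert by (intro finsum_insert) (auto intro!: finsum_closed)
  also have "\<dots> = (\<Oplus>j\<in>J. f x j) \<oplus> (\<Oplus>j\<in>J. \<Oplus>i\<in>I. f i j)"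
    using insert by simp
  also have "\<dots> = (\<Oplus>j\<in>J. f x j \<oplus> (\<Oplus>i\<in>I. f i j))"
    using insert by (intro finsum_addf[symmetric]) (auto intro!: finsum_closed)
  also have "\<dots> = (\<Oplus>j\<in>J. \<Oplus>i\<in>insert x I. f i j)"
    using insert by (intro finsum_cong') (auto intro!: finsum_closed finsum_insert[symmetric])
  finally show ?case .
qed

lemma (in abelian_group) finsum_minus:
  assumes "f \<in> I \<rightarrow> carrier G"
  shows "(\<Oplus>i\<in>I. \<ominus> f i) = \<ominus> (\<Oplus>i\<in>I. f i)"
  using assms
proof (induction I rule: infinite_finite_induct)
  case (insert x I)
  then have "(\<Oplus>i\<in>insert x I. \<ominus> f i) = \<ominus> f x \<oplus> (\<Oplus>i\<in>I. \<ominus> f i)"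
    by (intro finsum_insert) auto
  with insert show ?case
    by (simp add: minus_add Pi_iff)
qed (simp_all add: minus_equality[of \<zero> \<zero>])

lemma (in abelian_monoid) finsum_delta:
  assumes "finite I" "i \<in> I" "a \<in> carrier G"
  shows "(\<Oplus>j\<in>I. if i = j then a else \<zero>) = a"
  using finsum_singleton[of i I "\<lambda>_. a"] assms by simp

text \<open>\<open>ring_det\<close> writes the sign as an integer multiple (\<open>add_pow\<close>
  with \<open>sign p\<close>). A case distinction on parity is easier to move through sums, products
  and derivations.\<close>

definition (in ring) signed :: "(nat \<Rightarrow> nat) \<Rightarrow> 'a \<Rightarrow> 'a" where
  "signed p x = (if evenperm p then x else \<ominus> x)"

lemma (in ring) signed_closed [simp]: "x \<in> carrier R \<Longrightarrow> signed p x \<in> carrier R"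
  by (simp add: signed_def)

lemma (in ring) signed_mult:
  "\<lbrakk>x \<in> carrier R; y \<in> carrier R\<rbrakk> \<Longrightarrow> signed p (x \<otimes> y) = x \<otimes> signed p y"
  by (simp add: signed_def r_minus)

lemma (in ring) signed_finsum:
  "f \<in> I \<rightarrow> carrier R \<Longrightarrow> signed p (\<Oplus>i\<in>I. f i) = (\<Oplus>i\<in>I. signed p (f i))"
  by (simp add: signed_def finsum_minus)

lemma (in ring) add_pow_sign:
  assumes "x \<in> carrier R"
  shows "[sign p] \<cdot> x = signed p x"
  using assms by (simp add: signed_def sign_def add_pow_int_ge add_pow_int_lt)

lemma (in ring) ring_det_signed:
  assumes "\<And>p. p permutes {..<n} \<Longrightarrow> (\<Otimes>i\<in>{..<n}. M i (p i)) \<in> carrier R"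
  shows "ring_det R n M = (\<Oplus>p\<in>{p. p permutes {..<n}}. signed p (\<Otimes>i\<in>{..<n}. M i (p i)))"
  unfolding ring_det_def using assms
  by (intro finsum_cong') (auto simp: add_pow_sign)

lemma lessThan_permutes_less: "p permutes {..<n} \<Longrightarrow> i < n \<Longrightarrow> p i < (n::nat)"
  using permutes_in_image[of p "{..<n}" i] by simp

context cring
begin

lemma ring_det_closed:
  assumes "\<And>i j. i < n \<Longrightarrow> j < n \<Longrightarrow> M i j \<in> carrier R"
  shows "ring_det R n M \<in> carrier R"
  unfolding ring_det_def using assms
  by (intro finsum_closed) (auto intro!: finprod_closed lessThan_permutes_less simp: add_pow_sign)

lemma finprod_split:
  assumes "finite I" "i \<in> I" "f \<in> I \<rightarrow> carrier R"
  shows "(\<Otimes>l\<in>I. f l) = f i \<otimes> (\<Otimes>l\<in>I - {i}. f l)"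
  using finprod_insert[of "I - {i}" i f] assms by (simp add: insert_absorb Pi_iff)

text \<open>Expansion along the row \<open>i\<close>, with the entries of the row \<open>k\<close> in place of those of the row \<open>i\<close>.\<close>

lemma ring_det_alien_row:
  assumes M: "\<And>i j. i < n \<Longrightarrow> j < n \<Longrightarrow> M i j \<in> carrier R" and i: "i < n" and k: "k < n"
  shows "(\<Oplus>p\<in>{p. p permutes {..<n}}. signed p (M k (p i) \<otimes> (\<Otimes>l\<in>{..<n}-{i}. M l (p l)))) =
    (if i = k then ring_det R n M else \<zero>)"
proof (cases "i = k")
  case True
  have *: "(\<Otimes>l\<in>{..<n}. M l (p l)) = M i (p i) \<otimes> (\<Otimes>l\<in>{..<n}-{i}. M l (p l))"
    if "p permutes {..<n}" for p
    using i that M by (intro finprod_split) (auto intro: lessThan_permutes_less)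
  have "ring_det R n M = (\<Oplus>p\<in>{p. p permutes {..<n}}. signed p (\<Otimes>i\<in>{..<n}. M i (p i)))"
    using M by (intro ring_det_signed) (auto intro!: finprod_closed lessThan_permutes_less)
  also have "\<dots> = (\<Oplus>p\<in>{p. p permutes {..<n}}. signed p (M i (p i) \<otimes> (\<Otimes>l\<in>{..<n}-{i}. M l (p l))))"
    using M i by (intro finsum_cong')
      (auto simp: * intro!: signed_closed m_closed finprod_closed lessThan_permutes_less)
  finally show ?thesis using True by simp
next
  case False
  \<comment> \<open>The matrix with row \<open>k\<close> copied into row \<open>i\<close> has two
    equal rows. Composing with the transposition of \<open>i\<close> and \<open>k\<close> pairs each
    even permutation with an odd one having the same product \<open>f\<close>, so the terms
    cancel.\<close>
  let ?P = "{p. p permutes {..<n}}"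
  let ?E = "{p. p permutes {..<n} \<and> evenperm p}" and ?O = "{p. p permutes {..<n} \<and> \<not> evenperm p}"
  define f where "f p = M k (p i) \<otimes> (\<Otimes>l\<in>{..<n}-{i}. M l (p l))" for p
  let ?t = "transpose i k"
  have perm: "permutation p" if "p permutes {..<n}" for p
    using that permutation_permutes by blast
  have t: "?t permutes {..<n}" using i k by (intro permutes_swap_id) auto
  have fin: "finite ?P" by (simp add: finite_permutations)
  have f_closed: "f p \<in> carrier R" if "p permutes {..<n}" for p
    unfolding f_def using M i k that by (auto intro!: m_closed finprod_closed lessThan_permutes_less)
  have f_t: "f (p \<circ> ?t) = f p" if p: "p permutes {..<n}" for p
  proof -
    have "(\<Otimes>l\<in>{..<n}-{i}. M l (q l)) = M k (q k) \<otimes> (\<Otimes>l\<in>{..<n}-{i}-{k}. M l (q l))"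
      if "q permutes {..<n}" for q
      using M that False k by (intro finprod_split) (auto intro: lessThan_permutes_less)
    then have *: "f q = M k (q i) \<otimes> (M k (q k) \<otimes> (\<Otimes>l\<in>{..<n}-{i}-{k}. M l (q l)))"
      if "q permutes {..<n}" for q
      using that by (simp add: f_def)
    have "(\<Otimes>l\<in>{..<n}-{i}-{k}. M l ((p \<circ> ?t) l)) = (\<Otimes>l\<in>{..<n}-{i}-{k}. M l (p l))"
      using M p by (intro finprod_cong') (auto simp: transpose_def intro!: lessThan_permutes_less)
    moreover have "(\<Otimes>l\<in>{..<n}-{i}-{k}. M l (p l)) \<in> carrier R"
      using M p by (auto intro!: finprod_closed lessThan_permutes_less)
    moreover have "M k (p i) \<in> carrier R" "M k (p k) \<in> carrier R"
      using M p i k by (auto intro!: lessThan_permutes_less)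
    ultimately show ?thesis
      using p t by (simp add: * permutes_compose m_lcomm)
  qed
  have odd: "evenperm (p \<circ> ?t) \<longleftrightarrow> \<not> evenperm p" if "p permutes {..<n}" for p
    using evenperm_comp[OF perm[OF that] perm[OF t]] False by (simp add: evenperm_swap)
  have tt: "p \<circ> ?t \<circ> ?t = p" for p :: "nat \<Rightarrow> nat" by (simp add: comp_assoc)
  have O: "?O = (\<lambda>p. p \<circ> ?t) ` ?E"
  proof
    show "?O \<subseteq> (\<lambda>p. p \<circ> ?t) ` ?E"
    proof
      fix p assume "p \<in> ?O"
      then have "p \<circ> ?t \<in> ?E" using odd t by (auto intro: permutes_compose)
      then show "p \<in> (\<lambda>p. p \<circ> ?t) ` ?E" by (rule rev_image_eqI) (simp only: tt)
    qed
    show "(\<lambda>p. p \<circ> ?t) ` ?E \<subseteq> ?O" using odd t by (auto intro: permutes_compose)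
  qed
  have f_t_closed: "f (p \<circ> ?t) \<in> carrier R" if "p permutes {..<n}" for p
    using that f_t f_closed by simp
  have inj: "inj_on (\<lambda>p. p \<circ> ?t) ?E" by (metis (no_types, lifting) inj_onI tt)
  have "(\<Oplus>p\<in>?P. signed p (f p)) = (\<Oplus>p\<in>?E \<union> ?O. signed p (f p))"
    by (rule arg_cong[of _ _ "finsum R _"]) auto
  also have "\<dots> = (\<Oplus>p\<in>?E. signed p (f p)) \<oplus> (\<Oplus>p\<in>?O. signed p (f p))"
    using fin f_closed by (intro finsum_Un_disjoint) auto
  also have "(\<Oplus>p\<in>?O. signed p (f p)) = (\<Oplus>p\<in>?E. signed (p \<circ> ?t) (f (p \<circ> ?t)))"
    unfolding O using inj f_t_closed by (intro finsum_reindex) auto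
  also have "\<dots> = (\<Oplus>p\<in>?E. \<ominus> signed p (f p))"
    using f_closed by (intro finsum_cong') (auto simp: f_t odd signed_def)
  also have "\<dots> = \<ominus> (\<Oplus>p\<in>?E. signed p (f p))"
    using f_closed by (intro finsum_minus) auto
  also have "(\<Oplus>p\<in>?E. signed p (f p)) \<oplus> \<dots> = \<zero>"
    using f_closed by (intro r_neg finsum_closed) auto
  finally show ?thesis using False by (simp add: f_def)
qed

end

section \<open>Derivations of rings and Jacobi's formula\<close>

locale ring_derivation = ring +
  fixes D :: "'a \<Rightarrow> 'a"
  assumes D_closed [simp]: "x \<in> carrier R \<Longrightarrow> D x \<in> carrier R"
    and D_add: "\<lbrakk>x \<in> carrier R; y \<in> carrier R\<rbrakk> \<Longrightarrow> D (x \<oplus> y) = D x \<oplus> D y"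
    and D_mult: "\<lbrakk>x \<in> carrier R; y \<in> carrier R\<rbrakk> \<Longrightarrow> D (x \<otimes> y) = D x \<otimes> y \<oplus> x \<otimes> D y"
begin

lemma D_zero [simp]: "D \<zero> = \<zero>"
  using D_add[of \<zero> \<zero>] by (metis D_closed add.l_cancel_one' r_zero zero_closed)

lemma D_one [simp]: "D \<one> = \<zero>"
  using D_mult[of \<one> \<one>] by (metis D_closed add.l_cancel_one' l_one one_closed r_one)

lemma D_minus: "x \<in> carrier R \<Longrightarrow> D (\<ominus> x) = \<ominus> D x"
  using D_add[of "\<ominus> x" x] by (simp add: l_neg minus_equality)

lemma D_finsum: "f \<in> I \<rightarrow> carrier R \<Longrightarrow> D (\<Oplus>i\<in>I. f i) = (\<Oplus>i\<in>I. D (f i))"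
proof (induction I rule: infinite_finite_induct)
  case (insert x I)
  then show ?case by (simp add: D_add Pi_iff)
qed auto


end

locale cring_derivation = ring_derivation + cring
begin

text \<open>The products over \<open>I - {i}\<close> have the shape used in
  \<open>ring_det_alien_row\<close>, so that differentiated Leibniz terms can be collected into row
  expansions.\<close>

lemma D_finprod:
  assumes "finite I" "f \<in> I \<rightarrow> carrier R"
  shows "D (\<Otimes>i\<in>I. f i) = (\<Oplus>i\<in>I. D (f i) \<otimes> (\<Otimes>l\<in>I - {i}. f l))"
  using assms
proof (induction I rule: finite_induct)
  case empty
  then show ?case by simp
next
  case (insert x I)
  have f: "f i \<in> carrier R" if "i \<in> I" for i
    using insert.prems that by auto
  have rest: "(\<Otimes>l\<in>insert x I - {i}. f l) = f x \<otimes> (\<Otimes>l\<in>I - {i}. f l)" if "i \<in> I" for i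
  proof -
    have "insert x I - {i} = insert x (I - {i})" using insert that by auto
    then show ?thesis using insert by (auto simp: Pi_iff)
  qed
  have "D (\<Otimes>i\<in>insert x I. f i) = D (f x) \<otimes> (\<Otimes>i\<in>I. f i) \<oplus> f x \<otimes> D (\<Otimes>i\<in>I. f i)"
    using insert by (simp add: D_mult Pi_iff)
  also have "f x \<otimes> D (\<Otimes>i\<in>I. f i) = f x \<otimes> (\<Oplus>i\<in>I. D (f i) \<otimes> (\<Otimes>l\<in>I - {i}. f l))"
    using insert by simp
  also have "\<dots> = (\<Oplus>i\<in>I. f x \<otimes> (D (f i) \<otimes> (\<Otimes>l\<in>I - {i}. f l)))"
    using insert.hyps insert.prems by (intro finsum_rdistr) (auto simp: f)
  also have "\<dots> = (\<Oplus>i\<in>I. D (f i) \<otimes> (\<Otimes>l\<in>insert x I - {i}. f l))"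
    using insert.prems by (intro finsum_cong')
      (auto simp: rest f intro!: m_lcomm m_closed finprod_closed)
  also have "D (f x) \<otimes> (\<Otimes>i\<in>I. f i) = D (f x) \<otimes> (\<Otimes>i\<in>insert x I - {x}. f i)"
    using insert by simp
  finally show ?case
    using insert.prems insert.hyps
    by (subst finsum_insert) (auto simp: Pi_iff intro!: m_closed finprod_closed)
qed

text \<open>
  Jacobi's formula: if the derivation acts on the symmetric matrix \<open>M\<close> as \<open>b M + (b M)\<^sup>T\<close>, then
  each summand contributes \<open>tr b \<cdot> det M\<close>; the second one after passing from \<open>p\<close> to its inverse.
\<close>

lemma D_ring_det:
  assumes M: "\<And>i j. i < n \<Longrightarrow> j < n \<Longrightarrow> M i j \<in> carrier R"
    and sym: "\<And>i j. i < n \<Longrightarrow> j < n \<Longrightarrow> M i j = M j i"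
    and b: "\<And>i j. i < n \<Longrightarrow> j < n \<Longrightarrow> b i j \<in> carrier R"
    and DM: "\<And>i j. i < n \<Longrightarrow> j < n \<Longrightarrow>
      D (M i j) = (\<Oplus>k\<in>{..<n}. b i k \<otimes> M k j) \<oplus> (\<Oplus>k\<in>{..<n}. b j k \<otimes> M k i)"
  shows "D (ring_det R n M) = ring_det R n M \<otimes> ((\<Oplus>i\<in>{..<n}. b i i) \<oplus> (\<Oplus>i\<in>{..<n}. b i i))"
proof -
  let ?P = "{p. p permutes {..<n}}" and ?d = "ring_det R n M"
  \<comment> \<open>\<open>E\<close> is the matrix \<open>b M\<close>, \<open>Q p i\<close> the
    Leibniz product without the factor of row \<open>i\<close>, and \<open>g p\<close> the share of
    \<open>b M\<close> in the derivative of the term of \<open>p\<close>.\<close>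
  define E where "E i j = (\<Oplus>k\<in>{..<n}. b i k \<otimes> M k j)" for i j
  define Q where "Q p i = (\<Otimes>l\<in>{..<n}-{i}. M l (p l))" for p i
  define g where "g p = (\<Oplus>i\<in>{..<n}. E i (p i) \<otimes> Q p i)" for p
  have E: "E i j \<in> carrier R" if "i < n" "j < n" for i j
    unfolding E_def using that M b by (auto intro!: finsum_closed)
  have Q: "Q p i \<in> carrier R" if "p permutes {..<n}" for p i
    unfolding Q_def using that M by (auto intro!: finprod_closed lessThan_permutes_less)
  have less: "p i < n" if "p permutes {..<n}" "i < n" for p i
    using that by (rule lessThan_permutes_less)
  have g: "g p \<in> carrier R" if "p permutes {..<n}" for p
    unfolding g_def using that E Q less by (auto intro!: finsum_closed)
  have fin: "finite ?P" by (simp add: finite_permutations)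
  have d: "?d \<in> carrier R" using M by (rule ring_det_closed)
  \<comment> \<open>Reindex by \<open>j = p i\<close>. The symmetry of \<open>M\<close> turns the
    factors \<open>M l (p l)\<close> into \<open>M (p l) l\<close>, which belong to the inverse
    permutation; so the transposed share at \<open>p\<close> is the plain share at its
    inverse.\<close>
  have inverse_sum: "(\<Oplus>i\<in>{..<n}. E (p i) i \<otimes> Q p i) = g (inv_into UNIV p)" if p: "p permutes {..<n}" for p
  proof -
    have Qinv: "Q p i = Q (inv_into UNIV p) (p i)" if "i < n" for i
    proof -
      have im: "p ` ({..<n} - {i}) = {..<n} - {p i}"
        using p permutes_image[OF p] permutes_inj[OF p] by (auto simp: image_set_diff)
      have "Q (inv_into UNIV p) (p i) = (\<Otimes>m\<in>p ` ({..<n} - {i}). M m (inv_into UNIV p m))"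
        by (simp add: Q_def im)
      also have "\<dots> = (\<Otimes>l\<in>{..<n}-{i}. M (p l) (inv_into UNIV p (p l)))"
        using p permutes_inv[OF p] permutes_inj[OF p]
        by (intro finprod_reindex) (auto simp: im intro!: M less[OF permutes_inv[OF p]] intro: inj_on_subset)
      also have "\<dots> = Q p i"
        unfolding Q_def using p by (intro finprod_cong') (auto simp: permutes_inverses(2)[OF p] less[OF p] intro!: M sym)
      finally show ?thesis by simp
    qed
    have pinv: "inv_into UNIV p permutes {..<n}" using p by (rule permutes_inv)
    have "g (inv_into UNIV p) = (\<Oplus>j\<in>p ` {..<n}. E j (inv_into UNIV p j) \<otimes> Q (inv_into UNIV p) j)"
      by (simp add: g_def permutes_image[OF p])
    also have "\<dots> = (\<Oplus>i\<in>{..<n}. E (p i) (inv_into UNIV p (p i)) \<otimes> Q (inv_into UNIV p) (p i))"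
      using E Q[OF pinv] p permutes_inj[OF p] less less[OF pinv]
      by (intro finsum_reindex) (auto intro: inj_on_subset)
    also have "\<dots> = (\<Oplus>i\<in>{..<n}. E (p i) i \<otimes> Q p i)"
      using E Q p permutes_inverses(2)[OF p] less Qinv by (intro finsum_cong') (auto intro!: m_closed)
    finally show ?thesis by simp
  qed
  have D_term: "D (\<Otimes>i\<in>{..<n}. M i (p i)) = g p \<oplus> g (inv_into UNIV p)" if p: "p permutes {..<n}" for p
  proof -
    have "D (\<Otimes>i\<in>{..<n}. M i (p i)) = (\<Oplus>i\<in>{..<n}. D (M i (p i)) \<otimes> Q p i)"
      unfolding Q_def using M p less by (intro D_finprod) auto
    also have "\<dots> = (\<Oplus>i\<in>{..<n}. E i (p i) \<otimes> Q p i \<oplus> E (p i) i \<otimes> Q p i)"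
      using p less[OF p] E Q[OF p] DM
      by (intro finsum_cong') (auto simp: E_def[symmetric] l_distr)
    also have "\<dots> = g p \<oplus> (\<Oplus>i\<in>{..<n}. E (p i) i \<otimes> Q p i)"
      unfolding g_def using less[OF p] E Q[OF p] by (intro finsum_addf) auto
    finally show ?thesis using inverse_sum[OF p] by simp
  qed
  have sum_g: "(\<Oplus>p\<in>?P. signed p (g p)) = (\<Oplus>i\<in>{..<n}. b i i) \<otimes> ?d"
  proof -
    \<comment> \<open>Expand \<open>E i (p i)\<close> over \<open>k\<close> and exchange the sums:
      the inner sum is the determinant with row \<open>i\<close> replaced by row \<open>k\<close>,
      so only \<open>k = i\<close> survives.\<close>
    have row: "(\<Oplus>p\<in>?P. signed p (E i (p i) \<otimes> Q p i)) = b i i \<otimes> ?d" if i: "i < n" for i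
    proof -
      have "(\<Oplus>p\<in>?P. signed p (E i (p i) \<otimes> Q p i)) =
        (\<Oplus>p\<in>?P. \<Oplus>k\<in>{..<n}. b i k \<otimes> signed p (M k (p i) \<otimes> Q p i))"
      proof (intro finsum_cong' refl)
        fix p assume "p \<in> ?P"
        then have p: "p permutes {..<n}" by simp
        have "E i (p i) \<otimes> Q p i = (\<Oplus>k\<in>{..<n}. b i k \<otimes> M k (p i) \<otimes> Q p i)"
          unfolding E_def using M b p i less Q by (intro finsum_ldistr) auto
        then show "signed p (E i (p i) \<otimes> Q p i) = (\<Oplus>k\<in>{..<n}. b i k \<otimes> signed p (M k (p i) \<otimes> Q p i))"
          using M b p i less Q
          by (auto simp: signed_finsum signed_mult[symmetric] m_assoc intro!: finsum_cong')
      qed (use M b i less Q in \<open>auto intro!: finsum_closed\<close>)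
      also have "\<dots> = (\<Oplus>k\<in>{..<n}. \<Oplus>p\<in>?P. b i k \<otimes> signed p (M k (p i) \<otimes> Q p i))"
        using fin M b i less Q by (intro finsum_swap) auto
      also have "\<dots> = (\<Oplus>k\<in>{..<n}. b i k \<otimes> (\<Oplus>p\<in>?P. signed p (M k (p i) \<otimes> Q p i)))"
        using fin M b i less Q
        by (intro finsum_cong' refl finsum_rdistr[symmetric]) (auto intro!: finsum_closed)
      also have "\<dots> = (\<Oplus>k\<in>{..<n}. if i = k then b i i \<otimes> ?d else \<zero>)"
        using b d i ring_det_alien_row[of n M i] M
        by (intro finsum_cong') (auto simp: Q_def)
      also have "\<dots> = b i i \<otimes> ?d" using i b d by (intro finsum_delta) auto
      finally show ?thesis .
    qed
    have "(\<Oplus>p\<in>?P. signed p (g p)) = (\<Oplus>p\<in>?P. \<Oplus>i\<in>{..<n}. signed p (E i (p i) \<otimes> Q p i))"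
      using E Q less unfolding g_def
      by (intro finsum_cong' refl) (auto intro!: finsum_closed signed_finsum)
    also have "\<dots> = (\<Oplus>i\<in>{..<n}. \<Oplus>p\<in>?P. signed p (E i (p i) \<otimes> Q p i))"
      using fin E less Q by (intro finsum_swap) auto
    also have "\<dots> = (\<Oplus>i\<in>{..<n}. b i i \<otimes> ?d)"
      using b d by (intro finsum_cong') (auto simp: row)
    also have "\<dots> = (\<Oplus>i\<in>{..<n}. b i i) \<otimes> ?d"
      using b d by (intro finsum_ldistr[symmetric]) auto
    finally show ?thesis .
  qed
  \<comment> \<open>Inversion is a bijection of the permutations and preserves parity.\<close>
  have sum_g_inv: "(\<Oplus>p\<in>?P. signed p (g (inv_into UNIV p))) = (\<Oplus>p\<in>?P. signed p (g p))"
  proof -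
    have P: "inv_into UNIV ` ?P = ?P"
      using image_inverse_permutations[of "{..<n}"] by (auto simp: image_def)
    have "(\<Oplus>p\<in>?P. signed p (g p)) = (\<Oplus>p\<in>inv_into UNIV ` ?P. signed p (g p))"
      by (simp only: P)
    also have "\<dots> = (\<Oplus>p\<in>?P. signed (inv_into UNIV p) (g (inv_into UNIV p)))"
    proof (rule finsum_reindex)
      show "inj_on (inv_into UNIV) ?P"
        by (rule inj_onI) (metis mem_Collect_eq permutes_inv_inv)
    qed (use P g in auto)
    also have "\<dots> = (\<Oplus>p\<in>?P. signed p (g (inv_into UNIV p)))"
    proof (intro finsum_cong' refl)
      fix p assume "p \<in> ?P"
      then have "evenperm (inv_into UNIV p) = evenperm p"
        using evenperm_inv permutation_permutes by blast
      then show "signed (inv_into UNIV p) (g (inv_into UNIV p)) = signed p (g (inv_into UNIV p))"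
        by (simp add: signed_def)
    qed (use g[OF permutes_inv] in auto)
    finally show ?thesis by simp
  qed
  have prod: "(\<Otimes>i\<in>{..<n}. M i (p i)) \<in> carrier R" if "p permutes {..<n}" for p
    using M less that by (auto intro!: finprod_closed)
  have "D ?d = D (\<Oplus>p\<in>?P. signed p (\<Otimes>i\<in>{..<n}. M i (p i)))"
    using prod by (subst ring_det_signed) auto
  also have "\<dots> = (\<Oplus>p\<in>?P. D (signed p (\<Otimes>i\<in>{..<n}. M i (p i))))"
    using prod by (intro D_finsum) auto
  also have "\<dots> = (\<Oplus>p\<in>?P. signed p (g p) \<oplus> signed p (g (inv_into UNIV p)))"
    using g g[OF permutes_inv] prod
    by (intro finsum_cong') (auto simp: D_minus D_term signed_def minus_add)
  also have "\<dots> = (\<Oplus>p\<in>?P. signed p (g p)) \<oplus> (\<Oplus>p\<in>?P. signed p (g (inv_into UNIV p)))"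
    using g g[OF permutes_inv] by (intro finsum_addf) auto
  finally show ?thesis
    unfolding sum_g_inv sum_g using b d by (simp add: r_distr m_comm)
qed

end


section \<open>The discriminant under a derivation\<close>

text \<open>Trace and determinant are summed in the record with carrier \<open>C\<close>, basis
  expansions in the large ring; this passes between the two. For infinite \<open>I\<close> both sums
  default to the same zero.\<close>

lemma (in ring) finsum_subring:
  assumes "subring C R" "f \<in> I \<rightarrow> C"
  shows "finsum (R\<lparr>carrier := C\<rparr>) f I = finsum R f I"
proof -
  interpret A: ring "R\<lparr>carrier := C\<rparr>" using assms(1) by (rule subring_is_ring)
  show ?thesis using assms(2) subringE(1)[OF assms(1)]
  proof (induction I rule: infinite_finite_induct)
    case (insert x I)
    then have "f \<in> I \<rightarrow> carrier R" "f x \<in> carrier R" by auto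
    with insert show ?case by (simp add: Pi_iff)
  next
    case empty
    show ?case using A.finsum_empty finsum_empty by simp
  next
    case (infinite I)
    then show ?case using A.finsum_infinite[of I f] by (simp add: finsum_infinite)
  qed
qed

locale free_central_algebra = ring S for S :: "('a, 'm) ring_scheme" (structure) +
  fixes C :: "'a set" and N :: nat and y :: "nat \<Rightarrow> 'a"
  assumes subring: "subring C S"
    and central: "\<lbrakk>c \<in> C; s \<in> carrier S\<rbrakk> \<Longrightarrow> c \<otimes> s = s \<otimes> c"
    and basis: "module_basis S C N y"
begin

abbreviation coord :: "nat \<Rightarrow> 'a \<Rightarrow> 'a" where
  "coord i s \<equiv> basis_coords S C N y s i"

abbreviation tr :: "'a \<Rightarrow> 'a" where
  "tr \<equiv> algebra_trace S C N y"

section \<open>Coordinates in a basis over the central subring\<close>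

lemmas C_closed = subringE(1-3,5-7)[OF subring]

lemma C_carrier [simp]: "c \<in> C \<Longrightarrow> c \<in> carrier S"
  using C_closed(1) by auto

lemma cring_C: "cring (S\<lparr>carrier := C\<rparr>)"
  using subcring_iff[OF C_closed(1)] subcringI[OF subring] central by simp

lemma finsum_C_closed: "f \<in> I \<rightarrow> C \<Longrightarrow> finsum S f I \<in> C"
proof (induction I rule: infinite_finite_induct)
  case (insert x I)
  then have "f \<in> I \<rightarrow> C" "f x \<in> C" by auto
  moreover from this have "f \<in> I \<rightarrow> carrier S" by (simp add: Pi_iff)
  ultimately show ?case using insert by (simp add: C_closed)
qed (simp_all add: C_closed)

lemma y_closed [simp]: "i < N \<Longrightarrow> y i \<in> carrier S"
  using basis by (auto simp: module_basis_def)

text \<open>\<open>module_basis\<close> speaks of vanishing combinations only, so independence is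
  applied to the differences \<open>c i \<oplus> \<ominus> c' i\<close>.\<close>

lemma coeffs_unique:
  assumes c: "c \<in> {..<N} \<rightarrow> C" and c': "c' \<in> {..<N} \<rightarrow> C"
    and eq: "(\<Oplus>i\<in>{..<N}. c i \<otimes> y i) = (\<Oplus>i\<in>{..<N}. c' i \<otimes> y i)" and i: "i < N"
  shows "c i = c' i"
proof -
  have mem: "c i \<in> C" "c' i \<in> C" if "i < N" for i using c c' that by auto
  have "(\<Oplus>i\<in>{..<N}. (c i \<oplus> \<ominus> c' i) \<otimes> y i) = (\<Oplus>i\<in>{..<N}. c i \<otimes> y i \<oplus> \<ominus> (c' i \<otimes> y i))"
    using mem by (intro finsum_cong') (auto simp: l_distr l_minus)
  also have "\<dots> = (\<Oplus>i\<in>{..<N}. c i \<otimes> y i) \<oplus> (\<Oplus>i\<in>{..<N}. \<ominus> (c' i \<otimes> y i))"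
    using mem by (intro finsum_addf) auto
  also have "(\<Oplus>i\<in>{..<N}. \<ominus> (c' i \<otimes> y i)) = \<ominus> (\<Oplus>i\<in>{..<N}. c' i \<otimes> y i)"
    using mem by (intro finsum_minus) auto
  also have "(\<Oplus>i\<in>{..<N}. c i \<otimes> y i) \<oplus> \<dots> = \<zero>"
    unfolding eq using mem by (intro r_neg finsum_closed) auto
  finally have zero: "(\<Oplus>i\<in>{..<N}. (c i \<oplus> \<ominus> c' i) \<otimes> y i) = \<zero>" .
  have "(\<lambda>i. c i \<oplus> \<ominus> c' i) \<in> {..<N} \<rightarrow> C"
    using mem by (auto intro!: C_closed)
  with zero basis i have "c i \<oplus> \<ominus> c' i = \<zero>"
    unfolding module_basis_def by (elim conjE) (drule (1) bspec, simp)
  then show ?thesis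
    using mem[OF i] by (metis C_carrier a_inv_closed minus_equality minus_minus)
qed

text \<open>Existence and uniqueness justify the definite description in
  \<open>basis_coords\<close>. Coefficients are determined only on \<open>{..<N}\<close>; the
  extensional function space \<open>\<rightarrow>\<^sub>E\<close> fixes the values outside, which is
  why the witness is a restriction.\<close>

lemma
  assumes "s \<in> carrier S"
  shows coord_closed: "i < N \<Longrightarrow> coord i s \<in> C"
    and coord_expand: "s = (\<Oplus>i\<in>{..<N}. coord i s \<otimes> y i)"
proof -
  let ?P = "\<lambda>c. c \<in> {..<N} \<rightarrow>\<^sub>E C \<and> s = (\<Oplus>i\<in>{..<N}. c i \<otimes> y i)"
  obtain c where c: "c \<in> {..<N} \<rightarrow> C" "s = (\<Oplus>i\<in>{..<N}. c i \<otimes> y i)"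
    using basis assms unfolding module_basis_def by blast
  have "(\<Oplus>i\<in>{..<N}. restrict c {..<N} i \<otimes> y i) = (\<Oplus>i\<in>{..<N}. c i \<otimes> y i)"
    using c(1) by (intro finsum_cong') (auto simp: Pi_iff)
  then have ex: "?P (restrict c {..<N})" using c by auto
  have uniq: "c1 = c2" if "?P c1" "?P c2" for c1 c2
  proof (rule PiE_ext)
    show "c1 \<in> {..<N} \<rightarrow>\<^sub>E C" "c2 \<in> {..<N} \<rightarrow>\<^sub>E C" using that by auto
    fix i assume "i \<in> {..<N}"
    moreover have "(\<Oplus>i\<in>{..<N}. c1 i \<otimes> y i) = (\<Oplus>i\<in>{..<N}. c2 i \<otimes> y i)"
      using that by (elim conjE) (erule (1) subst)
    moreover have "c1 \<in> {..<N} \<rightarrow> C" "c2 \<in> {..<N} \<rightarrow> C"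
      using that by (simp_all add: PiE_def)
    ultimately show "c1 i = c2 i" using coeffs_unique[of c1 c2 i] by simp
  qed
  have "\<exists>!c. ?P c" by (rule ex1I, rule ex, rule uniq, assumption, rule ex)
  then have "?P (basis_coords S C N y s)"
    unfolding basis_coords_def by (rule theI')
  then show "i < N \<Longrightarrow> coord i s \<in> C" "s = (\<Oplus>i\<in>{..<N}. coord i s \<otimes> y i)"
    by auto
qed

lemma coord_carrier [simp]: "\<lbrakk>s \<in> carrier S; i < N\<rbrakk> \<Longrightarrow> coord i s \<in> carrier S"
  using coord_closed by simp

lemma coord_commute:
  "\<lbrakk>s \<in> carrier S; u \<in> carrier S; i < N; k < N\<rbrakk> \<Longrightarrow> coord i s \<otimes> coord k u = coord k u \<otimes> coord i s"
  by (intro central coord_closed coord_carrier)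

lemma coord_eqI:
  assumes "c \<in> {..<N} \<rightarrow> C" "s = (\<Oplus>i\<in>{..<N}. c i \<otimes> y i)" "i < N"
  shows "coord i s = c i"
proof -
  have s: "s \<in> carrier S" using assms by (auto simp: Pi_iff intro!: finsum_closed)
  show ?thesis
  proof (rule coeffs_unique)
    show "(\<lambda>i. coord i s) \<in> {..<N} \<rightarrow> C" using coord_closed[OF s] by auto
    show "(\<Oplus>i\<in>{..<N}. coord i s \<otimes> y i) = (\<Oplus>i\<in>{..<N}. c i \<otimes> y i)"
      using coord_expand[OF s] assms(2) by simp
  qed (use assms in auto)
qed

lemma coord_add:
  assumes "s \<in> carrier S" "u \<in> carrier S" "i < N"
  shows "coord i (s \<oplus> u) = coord i s \<oplus> coord i u"
proof (rule coord_eqI)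
  have "s \<oplus> u = (\<Oplus>i\<in>{..<N}. coord i s \<otimes> y i) \<oplus> (\<Oplus>i\<in>{..<N}. coord i u \<otimes> y i)"
    using coord_expand assms by metis
  also have "\<dots> = (\<Oplus>i\<in>{..<N}. coord i s \<otimes> y i \<oplus> coord i u \<otimes> y i)"
    using assms by (intro finsum_addf[symmetric]) auto
  also have "\<dots> = (\<Oplus>i\<in>{..<N}. (coord i s \<oplus> coord i u) \<otimes> y i)"
    using assms by (intro finsum_cong') (auto simp: l_distr)
  finally show "s \<oplus> u = (\<Oplus>i\<in>{..<N}. (coord i s \<oplus> coord i u) \<otimes> y i)" .
qed (use assms coord_closed C_closed in auto)

lemma coord_smult:
  assumes "c \<in> C" "s \<in> carrier S" "i < N"
  shows "coord i (c \<otimes> s) = c \<otimes> coord i s"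
proof (rule coord_eqI)
  have "c \<otimes> s = c \<otimes> (\<Oplus>i\<in>{..<N}. coord i s \<otimes> y i)"
    using coord_expand assms by metis
  also have "\<dots> = (\<Oplus>i\<in>{..<N}. c \<otimes> (coord i s \<otimes> y i))"
    using assms by (intro finsum_rdistr) auto
  also have "\<dots> = (\<Oplus>i\<in>{..<N}. (c \<otimes> coord i s) \<otimes> y i)"
    using assms by (intro finsum_cong') (auto simp: m_assoc)
  finally show "c \<otimes> s = (\<Oplus>i\<in>{..<N}. (c \<otimes> coord i s) \<otimes> y i)" .
qed (use assms coord_closed C_closed in auto)

lemma coord_zero: "i < N \<Longrightarrow> coord i \<zero> = \<zero>"
  using coord_smult[of \<zero> \<zero> i] C_closed by simp

lemma coord_finsum:
  assumes "i < N" "f \<in> I \<rightarrow> carrier S"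
  shows "coord i (\<Oplus>j\<in>I. f j) = (\<Oplus>j\<in>I. coord i (f j))"
  using assms(2)
proof (induction I rule: infinite_finite_induct)
  case (insert x I)
  then have "f \<in> I \<rightarrow> carrier S" "f x \<in> carrier S" by auto
  with insert assms(1) show ?case by (simp add: coord_add Pi_iff)
qed (simp_all add: coord_zero assms(1))

text \<open>Matrix times vector: the coordinates of \<open>u\<close> are central and move past
  \<open>s\<close>, leaving the matrix of left multiplication by \<open>s\<close>.\<close>

lemma coord_mult:
  assumes "s \<in> carrier S" "u \<in> carrier S" "i < N"
  shows "coord i (s \<otimes> u) = (\<Oplus>k\<in>{..<N}. coord k u \<otimes> coord i (s \<otimes> y k))"
proof -
  have "s \<otimes> u = s \<otimes> (\<Oplus>k\<in>{..<N}. coord k u \<otimes> y k)"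
    using coord_expand assms by metis
  also have "\<dots> = (\<Oplus>k\<in>{..<N}. s \<otimes> (coord k u \<otimes> y k))"
    using assms by (intro finsum_rdistr) auto
  also have "\<dots> = (\<Oplus>k\<in>{..<N}. coord k u \<otimes> (s \<otimes> y k))"
  proof (intro finsum_cong' refl)
    fix k assume "k \<in> {..<N}"
    then have k: "k < N" by simp
    have "s \<otimes> (coord k u \<otimes> y k) = (s \<otimes> coord k u) \<otimes> y k"
      using k assms by (simp add: m_assoc)
    also have "s \<otimes> coord k u = coord k u \<otimes> s"
      using k assms by (intro central[symmetric] coord_closed)
    finally show "s \<otimes> (coord k u \<otimes> y k) = coord k u \<otimes> (s \<otimes> y k)"
      using k assms by (simp add: m_assoc)
  qed (use assms in auto)
  finally have "coord i (s \<otimes> u) = (\<Oplus>k\<in>{..<N}. coord i (coord k u \<otimes> (s \<otimes> y k)))"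
    using assms by (simp add: coord_finsum)
  also have "\<dots> = (\<Oplus>k\<in>{..<N}. coord k u \<otimes> coord i (s \<otimes> y k))"
    using assms coord_closed by (intro finsum_cong') (auto simp: coord_smult)
  finally show ?thesis .
qed

section \<open>The trace of left multiplication\<close>

lemma trace_eq:
  assumes "s \<in> carrier S"
  shows "tr s = (\<Oplus>i\<in>{..<N}. coord i (s \<otimes> y i))"
  unfolding algebra_trace_def left_mult_matrix_def
  using assms coord_closed by (intro finsum_subring subring) auto

lemma trace_closed: "s \<in> carrier S \<Longrightarrow> tr s \<in> C"
  using coord_closed by (auto simp: trace_eq intro!: finsum_C_closed)

lemma trace_add:
  assumes "s \<in> carrier S" "u \<in> carrier S"
  shows "tr (s \<oplus> u) = tr s \<oplus> tr u"
proof -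
  have "tr (s \<oplus> u) = (\<Oplus>i\<in>{..<N}. coord i (s \<otimes> y i) \<oplus> coord i (u \<otimes> y i))"
    using assms by (simp only: trace_eq a_closed, intro finsum_cong') (auto simp: l_distr coord_add)
  then show ?thesis using assms by (simp add: trace_eq finsum_addf)
qed

lemma trace_smult:
  assumes "c \<in> C" "s \<in> carrier S"
  shows "tr (c \<otimes> s) = c \<otimes> tr s"
proof -
  have "tr (c \<otimes> s) = (\<Oplus>i\<in>{..<N}. c \<otimes> coord i (s \<otimes> y i))"
    using assms by (simp only: trace_eq m_closed C_carrier, intro finsum_cong')
      (auto simp: m_assoc coord_smult)
  also have "\<dots> = c \<otimes> tr s"
    using assms by (simp add: trace_eq) (intro finsum_rdistr[symmetric]; auto)
  finally show ?thesis .
qed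

lemma trace_zero: "tr \<zero> = \<zero>"
  using trace_smult[of \<zero> \<zero>] C_closed trace_closed by simp

lemma trace_finsum:
  assumes "f \<in> I \<rightarrow> carrier S"
  shows "tr (\<Oplus>j\<in>I. f j) = (\<Oplus>j\<in>I. tr (f j))"
  using assms
proof (induction I rule: infinite_finite_induct)
  case (insert x I)
  then have "f \<in> I \<rightarrow> carrier S" "f x \<in> carrier S" by auto
  with insert trace_closed show ?case by (simp add: trace_add Pi_iff)
qed (simp_all add: trace_zero)

text \<open>The inner sums are the diagonal entries of the product of the two left multiplication
  matrices.\<close>

lemma trace_mult:
  assumes "s \<in> carrier S" "u \<in> carrier S"
  shows "tr (s \<otimes> u) = (\<Oplus>i\<in>{..<N}. \<Oplus>k\<in>{..<N}. coord k (u \<otimes> y i) \<otimes> coord i (s \<otimes> y k))"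
proof -
  have "tr (s \<otimes> u) = (\<Oplus>i\<in>{..<N}. coord i (s \<otimes> (u \<otimes> y i)))"
    using assms by (simp only: trace_eq m_closed, intro finsum_cong') (auto simp: m_assoc)
  also have "\<dots> = (\<Oplus>i\<in>{..<N}. \<Oplus>k\<in>{..<N}. coord k (u \<otimes> y i) \<otimes> coord i (s \<otimes> y k))"
    using assms by (intro finsum_cong' refl coord_mult) (auto intro!: finsum_closed)
  finally show ?thesis .
qed

text \<open>Exchanging the two sums of \<open>trace_mult\<close> swaps the roles of \<open>s\<close>
  and \<open>u\<close>, because coordinates lie in the central subring. This makes the Gram matrix
  symmetric although \<open>S\<close> may be noncommutative.\<close>

lemma trace_commute:
  assumes "s \<in> carrier S" "u \<in> carrier S"
  shows "tr (s \<otimes> u) = tr (u \<otimes> s)"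
proof -
  have "tr (s \<otimes> u) = (\<Oplus>i\<in>{..<N}. \<Oplus>k\<in>{..<N}. coord k (u \<otimes> y i) \<otimes> coord i (s \<otimes> y k))"
    using assms by (rule trace_mult)
  also have "\<dots> = (\<Oplus>k\<in>{..<N}. \<Oplus>i\<in>{..<N}. coord k (u \<otimes> y i) \<otimes> coord i (s \<otimes> y k))"
    using assms by (intro finsum_swap) auto
  also have "\<dots> = (\<Oplus>k\<in>{..<N}. \<Oplus>i\<in>{..<N}. coord i (s \<otimes> y k) \<otimes> coord k (u \<otimes> y i))"
    using assms by (intro finsum_cong' refl coord_commute) (auto intro!: finsum_closed)
  also have "\<dots> = tr (u \<otimes> s)"
    using assms by (intro trace_mult[symmetric])
  finally show ?thesis .
qed

end

text \<open>\<open>D\<close> need not be \<open>C\<close>-linear. Its stability on \<open>C\<close>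
  lets it act on coordinates and restrict to a derivation of \<open>C\<close>.\<close>

locale free_central_algebra_derivation = free_central_algebra + ring_derivation S D for D +
  assumes D_C: "c \<in> C \<Longrightarrow> D c \<in> C"
begin

text \<open>By the product rule on the basis expansion, \<open>D\<close> acts on the coefficients
  and, in addition, through its values \<open>D (y j)\<close> on the basis.\<close>

lemma coord_D:
  assumes "u \<in> carrier S" "i < N"
  shows "coord i (D u) = D (coord i u) \<oplus> (\<Oplus>j\<in>{..<N}. coord j u \<otimes> coord i (D (y j)))"
proof -
  have "D u = D (\<Oplus>j\<in>{..<N}. coord j u \<otimes> y j)"
    using coord_expand assms by metis
  also have "\<dots> = (\<Oplus>j\<in>{..<N}. D (coord j u) \<otimes> y j \<oplus> coord j u \<otimes> D (y j))"
    using assms by (subst D_finsum) (auto intro!: finsum_cong' simp: D_mult simp del: finsum_addf add.finprod_multf)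
  also have "\<dots> = (\<Oplus>j\<in>{..<N}. D (coord j u) \<otimes> y j) \<oplus> (\<Oplus>j\<in>{..<N}. coord j u \<otimes> D (y j))"
    using assms by (intro finsum_addf) auto
  finally have "coord i (D u) = coord i (\<Oplus>j\<in>{..<N}. D (coord j u) \<otimes> y j) \<oplus>
    (\<Oplus>j\<in>{..<N}. coord i (coord j u \<otimes> D (y j)))"
    using assms by (simp add: coord_add coord_finsum)
  also have "coord i (\<Oplus>j\<in>{..<N}. D (coord j u) \<otimes> y j) = D (coord i u)"
    using assms coord_closed D_C by (intro coord_eqI) auto
  also have "(\<Oplus>j\<in>{..<N}. coord i (coord j u \<otimes> D (y j))) =
    (\<Oplus>j\<in>{..<N}. coord j u \<otimes> coord i (D (y j)))"
    using assms coord_closed by (intro finsum_cong') (auto simp: coord_smult)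
  finally show ?thesis .
qed

text \<open>In matrix form: the correction terms form the trace of a commutator.\<close>

lemma trace_D:
  assumes s: "s \<in> carrier S"
  shows "tr (D s) = D (tr s)"
proof -
  \<comment> \<open>With \<open>L\<close> the matrix of \<open>s\<close> and \<open>B\<close> the
    matrix of \<open>D\<close> on the basis, \<open>?X\<close> is the trace of \<open>L B\<close>.
    Differentiating \<open>s \<otimes> y i\<close> produces it on one side and the trace of
    \<open>B L\<close> on the other, and the two cancel.\<close>
  let ?X = "\<Oplus>i\<in>{..<N}. \<Oplus>k\<in>{..<N}. coord k (D (y i)) \<otimes> coord i (s \<otimes> y k)"
  have X: "?X \<in> carrier S" using s by (auto intro!: finsum_closed)
  have tr: "tr s \<in> carrier S" "tr (D s) \<in> carrier S" using s trace_closed by auto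
  have "?X = (\<Oplus>i\<in>{..<N}. coord i (s \<otimes> D (y i)))"
    using s by (intro finsum_cong' refl coord_mult[symmetric]) auto
  then have "tr (D s) \<oplus> ?X = (\<Oplus>i\<in>{..<N}. coord i (D s \<otimes> y i) \<oplus> coord i (s \<otimes> D (y i)))"
    using s by (simp add: trace_eq finsum_addf)
  also have "\<dots> = (\<Oplus>i\<in>{..<N}. D (coord i (s \<otimes> y i)) \<oplus>
    (\<Oplus>k\<in>{..<N}. coord k (s \<otimes> y i) \<otimes> coord i (D (y k))))"
  proof (intro finsum_cong' refl)
    fix i assume "i \<in> {..<N}"
    then have i: "i < N" by simp
    then have "coord i (D s \<otimes> y i) \<oplus> coord i (s \<otimes> D (y i)) = coord i (D (s \<otimes> y i))"
      using s by (simp add: D_mult coord_add)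
    then show "coord i (D s \<otimes> y i) \<oplus> coord i (s \<otimes> D (y i)) = D (coord i (s \<otimes> y i)) \<oplus>
      (\<Oplus>k\<in>{..<N}. coord k (s \<otimes> y i) \<otimes> coord i (D (y k)))"
      using s i by (simp add: coord_D)
  qed (use s in \<open>auto intro!: finsum_closed\<close>)
  also have "\<dots> = D (tr s) \<oplus> (\<Oplus>i\<in>{..<N}. \<Oplus>k\<in>{..<N}. coord k (s \<otimes> y i) \<otimes> coord i (D (y k)))"
    using s by (subst finsum_addf) (auto simp: trace_eq D_finsum intro!: finsum_closed)
  also have "(\<Oplus>i\<in>{..<N}. \<Oplus>k\<in>{..<N}. coord k (s \<otimes> y i) \<otimes> coord i (D (y k))) =
    (\<Oplus>k\<in>{..<N}. \<Oplus>i\<in>{..<N}. coord k (s \<otimes> y i) \<otimes> coord i (D (y k)))"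
    using s by (intro finsum_swap) auto
  also have "\<dots> = ?X"
    using s by (intro finsum_cong' refl coord_commute) (auto intro!: finsum_closed)
  finally show ?thesis using X tr by simp
qed

text \<open>\<open>D\<close> passes through the trace and splits \<open>y i \<otimes> y j\<close> by
  the product rule; \<open>trace_commute\<close> turns the second part into the first with
  \<open>i\<close> and \<open>j\<close> exchanged. This is the shape that \<open>D_ring_det\<close>
  requires.\<close>

lemma discriminant_D:
  shows "discriminant S C N y \<in> C"
    and "\<exists>c\<in>C. D (discriminant S C N y) = discriminant S C N y \<otimes> c"
proof -
  let ?A = "S\<lparr>carrier := C\<rparr>"
  let ?M = "\<lambda>i j. tr (y i \<otimes> y j)" and ?b = "\<lambda>i k. coord k (D (y i))"
  interpret A: cring ?A by (rule cring_C)
  interpret A: cring_derivation ?A D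
    by unfold_locales (auto simp: D_C D_add D_mult)
  have b: "?b i k \<in> C" if "i < N" "k < N" for i k using that coord_closed by simp
  have M: "?M i j \<in> C" if "i < N" "j < N" for i j using that trace_closed by simp
  show "discriminant S C N y \<in> C"
    using A.ring_det_closed[of N ?M] M by (simp add: discriminant_def)
  \<comment> \<open>For \<open>u = y j\<close> this is the entry \<open>(i, j)\<close> of
    \<open>b M\<close>, with \<open>b\<close> the coefficients of \<open>D (y i)\<close> in the
    basis.\<close>
  have left: "tr (D (y i) \<otimes> u) = (\<Oplus>\<^bsub>?A\<^esub>k\<in>{..<N}. ?b i k \<otimes> tr (y k \<otimes> u))"
    if "i < N" "u \<in> carrier S" for i u
  proof -
    have "D (y i) \<otimes> u = (\<Oplus>k\<in>{..<N}. ?b i k \<otimes> y k) \<otimes> u"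
      using coord_expand[of "D (y i)"] that by simp
    also have "\<dots> = (\<Oplus>k\<in>{..<N}. ?b i k \<otimes> y k \<otimes> u)"
      using that by (intro finsum_ldistr) auto
    finally have "tr (D (y i) \<otimes> u) = (\<Oplus>k\<in>{..<N}. tr (?b i k \<otimes> y k \<otimes> u))"
      using that by (simp add: trace_finsum)
    also have "\<dots> = (\<Oplus>k\<in>{..<N}. ?b i k \<otimes> tr (y k \<otimes> u))"
      using that b trace_closed by (intro finsum_cong') (auto simp: m_assoc trace_smult)
    also have "\<dots> = (\<Oplus>\<^bsub>?A\<^esub>k\<in>{..<N}. ?b i k \<otimes> tr (y k \<otimes> u))"
      using that b trace_closed by (intro finsum_subring[symmetric] subring) (auto intro!: C_closed)
    finally show ?thesis .
  qed
  have DM: "D (?M i j) = (\<Oplus>\<^bsub>?A\<^esub>k\<in>{..<N}. ?b i k \<otimes> ?M k j) \<oplus> (\<Oplus>\<^bsub>?A\<^esub>k\<in>{..<N}. ?b j k \<otimes> ?M k i)"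
    if "i < N" "j < N" for i j
  proof -
    have "D (?M i j) = tr (D (y i) \<otimes> y j) \<oplus> tr (y i \<otimes> D (y j))"
      using that by (simp add: trace_D[symmetric] D_mult trace_add)
    also have "tr (y i \<otimes> D (y j)) = tr (D (y j) \<otimes> y i)"
      using that by (intro trace_commute) auto
    finally show ?thesis using that by (simp add: left)
  qed
  \<comment> \<open>\<open>?t\<close> is the trace of \<open>b\<close>. It occurs twice in Jacobi's
    formula, once for \<open>b M\<close> and once for its transpose, whence the witness
    \<open>?t \<oplus> ?t\<close>.\<close>
  let ?t = "\<Oplus>\<^bsub>?A\<^esub>i\<in>{..<N}. ?b i i"
  have t: "?t \<in> C" using A.finsum_closed[of "\<lambda>i. ?b i i" "{..<N}"] b by auto
  have "D (ring_det ?A N ?M) = ring_det ?A N ?M \<otimes>\<^bsub>?A\<^esub> (?t \<oplus>\<^bsub>?A\<^esub> ?t)"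
    by (rule A.D_ring_det) (use M b DM in \<open>auto intro: trace_commute\<close>)
  then show "\<exists>c\<in>C. D (discriminant S C N y) = discriminant S C N y \<otimes> c"
    using t C_closed by (intro bexI[of _ "?t \<oplus> ?t"]) (auto simp: discriminant_def)
qed

end


section \<open>The bracket of a specialization\<close>

context ring
begin

abbreviation commutator :: "'a \<Rightarrow> 'a \<Rightarrow> 'a" where "commutator a b \<equiv> a \<otimes> b \<ominus> b \<otimes> a"

lemma commutator_add:
  assumes "a \<in> carrier R" "b \<in> carrier R" "x \<in> carrier R"
  shows "commutator (a \<oplus> b) x = commutator a x \<oplus> commutator b x"
  using assms by (simp add: a_minus_def l_distr r_distr minus_add a_ac)

lemma commutator_mult:
  assumes "a \<in> carrier R" "b \<in> carrier R" "x \<in> carrier R"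
  shows "commutator (a \<otimes> b) x = commutator a x \<otimes> b \<oplus> a \<otimes> commutator b x"
proof -
  \<comment> \<open>In the product rule the mixed term \<open>u\<close>, which is
    \<open>a \<otimes> x \<otimes> b\<close>, occurs with both signs.\<close>
  have cancel: "v \<oplus> \<ominus> w = (u \<oplus> \<ominus> w) \<oplus> (v \<oplus> \<ominus> u)"
    if "u \<in> carrier R" "v \<in> carrier R" "w \<in> carrier R" for u v w
  proof -
    have "(u \<oplus> \<ominus> w) \<oplus> (v \<oplus> \<ominus> u) = (u \<oplus> \<ominus> u) \<oplus> (v \<oplus> \<ominus> w)"
      using that by (simp only: a_ac a_inv_closed a_closed)
    then show ?thesis using that by (simp add: r_neg)
  qed
  show ?thesis
    using assms cancel[of "a \<otimes> (x \<otimes> b)" "a \<otimes> (b \<otimes> x)" "x \<otimes> (a \<otimes> b)"]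
    by (simp add: a_minus_def l_distr r_distr l_minus r_minus m_assoc)
qed

end

section \<open>Lifts along the specialization and division by the central element\<close>

locale central_regular_element = ring +
  fixes t
  assumes regular: "regular_element R t"
    and t_central: "x \<in> carrier R \<Longrightarrow> x \<otimes> t = t \<otimes> x"
begin

abbreviation S :: "'a set ring" where "S \<equiv> specialization R t"
abbreviation proj :: "'a \<Rightarrow> 'a set" where "proj \<equiv> spec_map R t"
lemma t_closed [simp]: "t \<in> carrier R"
  using regular by (simp add: regular_element_def)

text \<open>Regularity makes quotients by \<open>t\<close> unique, hence also the element described
  by \<open>THE\<close> in \<open>spec_bracket\<close>.\<close>

lemma t_cancel:
  assumes "t \<otimes> a = t \<otimes> b" "a \<in> carrier R" "b \<in> carrier R"
  shows "a = b"
proof -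
  have "t \<otimes> (a \<ominus> b) = \<zero>"
    using assms by (simp add: a_minus_def r_distr r_minus r_neg)
  then have "a \<ominus> b = \<zero>"
    using assms(2,3) regular unfolding regular_element_def by blast
  then show ?thesis using assms by (simp add: r_right_minus_eq)
qed

text \<open>Centrality of \<open>t\<close> makes its multiples a two-sided ideal.\<close>

lemma spec_ideal: "ideal (spec_ideal R t) R"
proof (rule idealI)
  show "ring R" by (rule ring_axioms)
  show "subgroup (spec_ideal R t) (add_monoid R)"
  proof (rule add.subgroupI)
    show "spec_ideal R t \<subseteq> carrier R" by (auto simp: spec_ideal_def)
    show "spec_ideal R t \<noteq> {}" by (auto simp: spec_ideal_def)
    fix a b assume "a \<in> spec_ideal R t" "b \<in> spec_ideal R t"
    then obtain a' b' where ab: "a = t \<otimes> a'" "b = t \<otimes> b'" "a' \<in> carrier R" "b' \<in> carrier R"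
      by (auto simp: spec_ideal_def)
    have "\<ominus> a = t \<otimes> (\<ominus> a')" "a \<oplus> b = t \<otimes> (a' \<oplus> b')"
      using ab by (simp_all add: r_minus r_distr)
    then show "\<ominus> a \<in> spec_ideal R t" "a \<oplus> b \<in> spec_ideal R t"
      using ab by (auto simp: spec_ideal_def)
  qed
  fix a x assume "a \<in> spec_ideal R t" and x: "x \<in> carrier R"
  then obtain a' where a: "a = t \<otimes> a'" "a' \<in> carrier R"
    by (auto simp: spec_ideal_def)
  have "x \<otimes> a = t \<otimes> (x \<otimes> a')" "a \<otimes> x = t \<otimes> (a' \<otimes> x)"
    using a x t_central[OF x] by (simp_all add: m_assoc[symmetric])
  then show "x \<otimes> a \<in> spec_ideal R t" "a \<otimes> x \<in> spec_ideal R t"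
    using a x by (auto simp: spec_ideal_def)
qed

lemma ring_S: "ring S"
  unfolding specialization_def using spec_ideal by (rule ideal.quotient_is_ring)

lemma proj_hom: "proj \<in> ring_hom R S"
  unfolding specialization_def spec_map_def[abs_def] using spec_ideal by (rule ideal.rcos_ring_hom)

lemma proj_closed [simp]: "a \<in> carrier R \<Longrightarrow> proj a \<in> carrier S"
  using proj_hom by (rule ring_hom_closed)

lemma proj_surj: "s \<in> carrier S \<Longrightarrow> \<exists>a\<in>carrier R. proj a = s"
  by (auto simp: specialization_def spec_map_def FactRing_simps)

lemma proj_t_mult: "a \<in> carrier R \<Longrightarrow> proj (t \<otimes> a) = \<zero>\<^bsub>S\<^esub>"
  using a_rcos_zero[OF spec_ideal, of "t \<otimes> a"]
  by (auto simp: spec_map_def specialization_def FactRing_def spec_ideal_def)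

lemma proj_eqD:
  assumes "proj a = proj b" "a \<in> carrier R" "b \<in> carrier R"
  shows "\<exists>u\<in>carrier R. a = b \<oplus> t \<otimes> u"
proof -
  have "a \<ominus> b \<in> spec_ideal R t"
    using assms quotient_eq_iff_same_a_r_cos[OF spec_ideal] by (simp add: spec_map_def)
  then obtain u where u: "u \<in> carrier R" "a \<ominus> b = t \<otimes> u"
    by (auto simp: spec_ideal_def)
  have "a = b \<oplus> (a \<ominus> b)" using assms by algebra
  then show ?thesis using u by auto
qed

context
  fixes x assumes x: "x \<in> ring_center S"
begin

text \<open>This is literally the choice that \<open>spec_bracket\<close> makes for its second
  argument, so that unfolding the bracket exposes \<open>lift\<close>.\<close>

definition lift :: 'a where "lift = (SOME a. a \<in> carrier R \<and> proj a = x)"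

lemma lift: "lift \<in> carrier R" "proj lift = x"
proof -
  have "\<exists>a. a \<in> carrier R \<and> proj a = x"
    using proj_surj x by (auto simp: ring_center_def)
  then have "lift \<in> carrier R \<and> proj lift = x"
    unfolding lift_def by (rule someI_ex)
  then show "lift \<in> carrier R" "proj lift = x" by auto
qed

text \<open>As \<open>x\<close> is central in \<open>S\<close>, the commutator projects to zero and
  is a multiple of \<open>t\<close>. The element \<open>a\<close> is arbitrary, which is what
  extends the bracket with \<open>x\<close> from the center to all of \<open>S\<close>.\<close>

lemma commutator_lift:
  assumes a: "a \<in> carrier R"
  obtains r where "r \<in> carrier R" "t \<otimes> r = commutator a lift"
proof -
  interpret S: ring S by (rule ring_S)
  have "proj (a \<otimes> lift) = proj a \<otimes>\<^bsub>S\<^esub> x" "proj (lift \<otimes> a) = x \<otimes>\<^bsub>S\<^esub> proj a"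
    using a lift ring_hom_mult[OF proj_hom] by auto
  moreover have "x \<otimes>\<^bsub>S\<^esub> proj a = proj a \<otimes>\<^bsub>S\<^esub> x"
    using x a by (auto simp: ring_center_def)
  ultimately obtain u where "u \<in> carrier R" "a \<otimes> lift = lift \<otimes> a \<oplus> t \<otimes> u"
    using proj_eqD[of "a \<otimes> lift" "lift \<otimes> a"] a lift by auto
  moreover from this have "t \<otimes> u = commutator a lift"
    using a lift by (simp add: a_minus_def a_comm[of _ "\<ominus> _"] r_neg1)
  ultimately show thesis using that by blast
qed

text \<open>The lift of the central argument is kept fixed, while any lift of the other one will do.\<close>

lemma spec_bracket_eq:
  assumes a: "a \<in> carrier R" and r: "r \<in> carrier R" and eq: "t \<otimes> r = commutator a lift"
  shows "spec_bracket R t (proj a) x = proj r"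
proof -
  interpret S: ring S by (rule ring_S)
  define b where "b = (SOME b. b \<in> carrier R \<and> proj b = proj a)"
  have "b \<in> carrier R \<and> proj b = proj a"
    unfolding b_def by (rule someI[of _ a]) (simp add: a)
  then have b: "b \<in> carrier R" "proj a = proj b" by simp_all
  obtain q where q: "q \<in> carrier R" "t \<otimes> q = commutator b lift"
    by (rule commutator_lift[OF b(1)])
  have the: "(THE q. q \<in> carrier R \<and> t \<otimes> q = commutator b lift) = q"
  proof (rule the_equality)
    fix q' assume "q' \<in> carrier R \<and> t \<otimes> q' = commutator b lift"
    then have "t \<otimes> q' = t \<otimes> q" "q' \<in> carrier R" by (simp_all only: q)
    then show "q' = q" using q(1) by (rule t_cancel)
  next
    show "q \<in> carrier R \<and> t \<otimes> q = commutator b lift" using q by (rule conjI)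
  qed
  \<comment> \<open>The given lift \<open>a\<close> and the chosen lift \<open>b\<close> differ by
    \<open>t \<otimes> u\<close>. This changes the commutator by
    \<open>t \<otimes> (t \<otimes> v)\<close>, hence the quotient by \<open>t \<otimes> v\<close>,
    which vanishes in \<open>S\<close>.\<close>
  obtain u where u: "u \<in> carrier R" "a = b \<oplus> t \<otimes> u"
    using proj_eqD[OF b(2) a b(1)] by blast
  obtain v where v: "v \<in> carrier R" "t \<otimes> v = commutator u lift"
    by (rule commutator_lift[OF u(1)])
  have lt: "lift \<otimes> (t \<otimes> u) = t \<otimes> (lift \<otimes> u)"
    using t_central[OF lift(1)] lift u by (simp add: m_assoc[symmetric])
  have "t \<otimes> r = commutator b lift \<oplus> commutator (t \<otimes> u) lift"
    unfolding eq u(2) using b u(1) lift(1) by (simp only: commutator_add m_closed t_closed)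
  also have "\<dots> = t \<otimes> q \<oplus> t \<otimes> (t \<otimes> v)"
    unfolding lt q(2) v(2) using b u(1) lift(1)
    by (simp add: a_minus_def r_distr r_minus m_assoc)
  also have "\<dots> = t \<otimes> (q \<oplus> t \<otimes> v)"
    using q(1) v(1) by (simp add: r_distr)
  finally have "r = q \<oplus> t \<otimes> v"
    by (rule t_cancel) (simp_all add: r q(1) v(1))
  then have "proj r = proj q"
    using q(1) v(1) ring_hom_add[OF proj_hom] proj_t_mult by simp
  then show ?thesis
    unfolding spec_bracket_def Let_def b_def[symmetric] lift_def[symmetric] the by simp
qed

text \<open>The commutator with \<open>lift\<close> is a derivation of \<open>R\<close>; dividing it
  by the central regular \<open>t\<close> keeps additivity and the product rule, and
  \<open>spec_bracket_eq\<close> transports both to \<open>S\<close>.\<close>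

lemma spec_bracket_derivation: "ring_derivation S (\<lambda>s. spec_bracket R t s x)"
proof -
  interpret S: ring S by (rule ring_S)
  have lifts: "\<exists>a r. a \<in> carrier R \<and> r \<in> carrier R \<and> s = proj a \<and> t \<otimes> r = commutator a lift \<and>
      spec_bracket R t s x = proj r" if s: "s \<in> carrier S" for s
  proof -
    obtain a where a: "a \<in> carrier R" "proj a = s" using proj_surj[OF s] by blast
    obtain r where r: "r \<in> carrier R" "t \<otimes> r = commutator a lift"
      by (rule commutator_lift[OF a(1)])
    show ?thesis using a r spec_bracket_eq[OF a(1) r] by (intro exI[of _ a] exI[of _ r]) simp
  qed
  show ?thesis
  proof
    fix s assume "s \<in> carrier S"
    then show "spec_bracket R t s x \<in> carrier S"
      using lifts by fastforce
  next
    fix s s' assume "s \<in> carrier S" "s' \<in> carrier S"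
    then obtain a r a' r' where
      a: "a \<in> carrier R" "r \<in> carrier R" "s = proj a" "t \<otimes> r = commutator a lift"
        "spec_bracket R t s x = proj r" and
      a': "a' \<in> carrier R" "r' \<in> carrier R" "s' = proj a'" "t \<otimes> r' = commutator a' lift"
        "spec_bracket R t s' x = proj r'"
      using lifts by metis
    have "t \<otimes> (r \<oplus> r') = t \<otimes> r \<oplus> t \<otimes> r'"
      using a(2) a'(2) by (simp add: r_distr)
    also have "\<dots> = commutator (a \<oplus> a') lift"
      unfolding a(4) a'(4) using a(1) a'(1) lift(1) by (simp only: commutator_add)
    finally have "spec_bracket R t (proj (a \<oplus> a')) x = proj (r \<oplus> r')"
      using a(1,2) a'(1,2) by (intro spec_bracket_eq) simp_all
    then show "spec_bracket R t (s \<oplus>\<^bsub>S\<^esub> s') x = spec_bracket R t s x \<oplus>\<^bsub>S\<^esub> spec_bracket R t s' x"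
      using a(1,2,3,5) a'(1,2,3,5) ring_hom_add[OF proj_hom] by simp
    have "t \<otimes> (a \<otimes> r') = a \<otimes> (t \<otimes> r')"
      using a(1) a'(2) t_central[OF a(1)] by (simp add: m_assoc[symmetric])
    then have "t \<otimes> (r \<otimes> a' \<oplus> a \<otimes> r') = (t \<otimes> r) \<otimes> a' \<oplus> a \<otimes> (t \<otimes> r')"
      using a(1,2) a'(1,2) by (simp add: r_distr m_assoc)
    also have "\<dots> = commutator (a \<otimes> a') lift"
      unfolding a(4) a'(4) using a(1) a'(1) lift(1) by (simp only: commutator_mult)
    finally have "spec_bracket R t (proj (a \<otimes> a')) x = proj (r \<otimes> a' \<oplus> a \<otimes> r')"
      using a(1,2) a'(1,2) by (intro spec_bracket_eq) simp_all
    then show "spec_bracket R t (s \<otimes>\<^bsub>S\<^esub> s') x =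
        spec_bracket R t s x \<otimes>\<^bsub>S\<^esub> s' \<oplus>\<^bsub>S\<^esub> s \<otimes>\<^bsub>S\<^esub> spec_bracket R t s' x"
      using a(1,2,3,5) a'(1,2,3,5) ring_hom_add[OF proj_hom] ring_hom_mult[OF proj_hom] by simp
  qed
qed

end

end


section \<open>Factorization of Poisson normal elements\<close>

lemma (in abelian_group) add_minus_cancel:
  "\<lbrakk>a \<in> carrier G; b \<in> carrier G\<rbrakk> \<Longrightarrow> (a \<oplus> b) \<oplus> \<ominus> a = b"
  by (simp add: a_comm[of a b] a_assoc r_neg)

lemma (in ideal) add_mem_cancel:
  assumes "u \<oplus> v \<in> I" "v \<in> I" "u \<in> carrier R"
  shows "u \<in> I"
proof -
  have "(v \<oplus> u) \<oplus> \<ominus> v \<in> I"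
    using assms Icarr[OF assms(2)] by (simp add: a_comm)
  then show ?thesis using add_minus_cancel[of v u] assms Icarr[OF assms(2)] by simp
qed

text \<open>Characteristic \<open>0\<close> enters as \<open>nat_unit\<close>: the integer factors
  that arise from differentiating powers can be divided out.\<close>

locale bracket_domain = domain +
  fixes br :: "'a \<Rightarrow> 'a \<Rightarrow> 'a"
  assumes derivation: "x \<in> carrier R \<Longrightarrow> ring_derivation R (\<lambda>a. br a x)"
    and nat_unit: "0 < (n::nat) \<Longrightarrow> [n] \<cdot> \<one> \<in> Units R"
begin

lemma br_closed [simp]: "\<lbrakk>a \<in> carrier R; x \<in> carrier R\<rbrakk> \<Longrightarrow> br a x \<in> carrier R"
  using ring_derivation.D_closed[OF derivation] by simp

lemma br_mult:
  "\<lbrakk>a \<in> carrier R; b \<in> carrier R; x \<in> carrier R\<rbrakk> \<Longrightarrow> br (a \<otimes> b) x = br a x \<otimes> b \<oplus> a \<otimes> br b x"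
  using ring_derivation.D_mult[OF derivation] by simp

lemma br_pow_Suc:
  fixes n :: nat
  assumes "a \<in> carrier R" "x \<in> carrier R"
  shows "br (a [^] Suc n) x = [Suc n] \<cdot> \<one> \<otimes> (a [^] n \<otimes> br a x)"
proof (induction n)
  case 0
  then show ?case using assms by simp
next
  case (Suc n)
  have "br (a [^] Suc (Suc n)) x = br (a [^] Suc n) x \<otimes> a \<oplus> a [^] Suc n \<otimes> br a x"
    using assms br_mult[of "a [^] Suc n" a x] by simp
  also have "br (a [^] Suc n) x \<otimes> a = [Suc n] \<cdot> \<one> \<otimes> (a [^] Suc n \<otimes> br a x)"
    unfolding Suc using assms by (simp add: m_ac del: add.nat_pow_Suc)
  also have "\<dots> \<oplus> a [^] Suc n \<otimes> br a x = [Suc (Suc n)] \<cdot> \<one> \<otimes> (a [^] Suc n \<otimes> br a x)"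
    using assms by (simp add: l_distr)
  finally show ?case .
qed

text \<open>The extra factor \<open>a\<close> makes up for the exponent lost in the power rule, so
  that the exponent \<open>0\<close> is covered as well.\<close>

lemma br_pow_mult:
  fixes n :: nat
  assumes "a \<in> carrier R" "x \<in> carrier R"
  shows "\<exists>c\<in>carrier R. br (a [^] n) x \<otimes> a = a [^] n \<otimes> c"
proof (cases n)
  case 0
  interpret D: ring_derivation R "\<lambda>a. br a x" using assms(2) by (rule derivation)
  show ?thesis using 0 assms by (intro bexI[of _ \<zero>]) auto
next
  case (Suc m)
  show ?thesis unfolding Suc br_pow_Suc[OF assms]
    using assms by (intro bexI[of _ "[Suc m] \<cdot> \<one> \<otimes> br a x"]) (simp_all add: m_ac del: add.nat_pow_Suc)
qed

lemma unit_mult_mem_ideal: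
  assumes "ideal I R" "e \<in> Units R" "a \<in> carrier R" "e \<otimes> a \<in> I"
  shows "a \<in> I"
proof -
  interpret ideal I R by (rule assms(1))
  have "inv e \<otimes> (e \<otimes> a) \<in> I" by (rule I_l_closed) (use assms in auto)
  then show ?thesis using assms(2,3) by (simp add: m_assoc[symmetric] Units_closed)
qed

lemma pow_nonzero: "\<lbrakk>a \<in> carrier R; a \<noteq> \<zero>\<rbrakk> \<Longrightarrow> a [^] (n::nat) \<noteq> \<zero>"
  by (induction n) (auto simp: integral_iff)

lemma prime_not_unit: "prime R p \<Longrightarrow> p \<notin> Units R"
  by (auto elim: primeE)

subsection \<open>Prime factors of Poisson normal elements\<close>

text \<open>In the product rule for \<open>p \<otimes> d'\<close> every term is a multiple of
  \<open>p\<close>, since \<open>p\<close> itself is Poisson normal; cancel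
  \<open>p\<close>.\<close>

lemma poisson_normal_cofactor:
  assumes p: "poisson_prime R br p" and d': "d' \<in> carrier R" and d: "poisson_normal R br (p \<otimes> d')"
  shows "poisson_normal R br d'"
  unfolding poisson_normal_def
proof (intro conjI ballI)
  show "d' \<in> carrier R" by fact
  fix x assume x: "x \<in> carrier R"
  have p': "p \<in> carrier R" "p \<noteq> \<zero>" using p by (auto simp: poisson_prime_def ring_prime_def)
  obtain c where c: "c \<in> carrier R" "br p x = p \<otimes> c"
    using p x by (auto simp: poisson_prime_def poisson_normal_def)
  obtain w where w: "w \<in> carrier R" "br (p \<otimes> d') x = p \<otimes> d' \<otimes> w"
    using d x by (auto simp: poisson_normal_def)
  have "p \<otimes> (c \<otimes> d' \<oplus> br d' x) = p \<otimes> (d' \<otimes> w)"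
    using w(2) c p' d' x w(1) by (simp add: br_mult r_distr m_assoc)
  then have "c \<otimes> d' \<oplus> br d' x = d' \<otimes> w"
    using p' c(1) d' x w(1) by (subst (asm) m_lcancel) auto
  moreover have "br d' x = (c \<otimes> d' \<oplus> br d' x) \<oplus> \<ominus> (d' \<otimes> c)"
    using add_minus_cancel[of "c \<otimes> d'" "br d' x"] c(1) d' x by (simp add: m_comm[of d' c])
  ultimately have "br d' x = d' \<otimes> (w \<oplus> \<ominus> c)"
    using c(1) d' w(1) by (simp add: r_distr r_minus)
  then show "\<exists>y\<in>carrier R. br d' x = d' \<otimes> y" using w(1) c(1) by auto
qed

text \<open>After cancelling \<open>p [^] n\<close>, every term but
  \<open>?e \<otimes> (br p x \<otimes> a)\<close> is visibly a multiple of \<open>p\<close>, hence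
  so is this one. The integer \<open>?e\<close> is a unit and \<open>p\<close> does not divide
  \<open>a\<close>, so \<open>p\<close> divides \<open>br p x\<close>.\<close>

lemma prime_factor_poisson_normal:
  fixes n :: nat
  assumes p: "p \<in> carrier R" "ring_prime p" and a: "a \<in> carrier R" "\<not> p divides a"
    and d: "poisson_normal R br (p [^] Suc n \<otimes> a)"
  shows "poisson_prime R br p"
proof -
  have "\<exists>y\<in>carrier R. br p x = p \<otimes> y" if x: "x \<in> carrier R" for x
  proof -
    let ?e = "[Suc n] \<cdot> \<one>"
    have e: "?e \<in> Units R" "?e \<in> carrier R" using nat_unit[of "Suc n"] by auto
    obtain w where w: "w \<in> carrier R" "br (p [^] Suc n \<otimes> a) x = p [^] Suc n \<otimes> a \<otimes> w"
      using d x by (auto simp: poisson_normal_def)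
    have pn: "p [^] n \<in> carrier R" "p [^] n \<noteq> \<zero>"
      using p pow_nonzero by (auto simp: ring_prime_def)
    have "br (p [^] Suc n \<otimes> a) x = p [^] n \<otimes> (?e \<otimes> (br p x \<otimes> a) \<oplus> p \<otimes> br a x)"
    proof -
      have "br (p [^] Suc n \<otimes> a) x = br (p [^] Suc n) x \<otimes> a \<oplus> p [^] Suc n \<otimes> br a x"
        using p(1) a(1) x by (intro br_mult) auto
      also have "br (p [^] Suc n) x \<otimes> a = p [^] n \<otimes> (?e \<otimes> (br p x \<otimes> a))"
        unfolding br_pow_Suc[OF p(1) x] using p(1) a(1) x e(2) by (simp add: m_ac del: add.nat_pow_Suc)
      also have "p [^] Suc n \<otimes> br a x = p [^] n \<otimes> (p \<otimes> br a x)"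
        using p(1) a(1) x by (simp add: m_assoc)
      finally show ?thesis using p(1) a(1) x e(2) by (simp add: r_distr del: add.nat_pow_Suc)
    qed
    then have "p [^] n \<otimes> (?e \<otimes> (br p x \<otimes> a) \<oplus> p \<otimes> br a x) = p [^] n \<otimes> (p \<otimes> (a \<otimes> w))"
      using w p(1) a(1) by (simp add: m_ac del: add.nat_pow_Suc)
    then have "?e \<otimes> (br p x \<otimes> a) \<oplus> p \<otimes> br a x = p \<otimes> (a \<otimes> w)"
      using pn p(1) a(1) x e(2) w(1) by (subst (asm) m_lcancel) auto
    moreover have "?e \<otimes> (br p x \<otimes> a) =
        (?e \<otimes> (br p x \<otimes> a) \<oplus> p \<otimes> br a x) \<oplus> \<ominus> (p \<otimes> br a x)"
      using p(1) a(1) x e(2) by (simp add: a_assoc r_neg del: add.nat_pow_Suc)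
    ultimately have "?e \<otimes> (br p x \<otimes> a) = p \<otimes> (a \<otimes> w \<oplus> \<ominus> br a x)"
      using p(1) a(1) x w(1) by (simp add: r_distr r_minus)
    also have "p \<otimes> (a \<otimes> w \<oplus> \<ominus> br a x) = (a \<otimes> w \<oplus> \<ominus> br a x) \<otimes> p"
      by (rule m_comm[OF p(1)]) (simp add: a(1) x w(1))
    finally have "?e \<otimes> (br p x \<otimes> a) = (a \<otimes> w \<oplus> \<ominus> br a x) \<otimes> p" .
    then have "?e \<otimes> (br p x \<otimes> a) \<in> PIdl p"
      unfolding cgenideal_def using a(1) x w(1)
      by (intro CollectI exI[of _ "a \<otimes> w \<oplus> \<ominus> br a x"] conjI) (simp_all del: add.nat_pow_Suc)
    then have "br p x \<otimes> a \<in> PIdl p"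
      by (rule unit_mult_mem_ideal[OF cgenideal_ideal[OF p(1)] e(1), rotated])
        (simp add: p(1) a(1) x)
    then obtain z where "z \<in> carrier R" "br p x \<otimes> a = z \<otimes> p"
      by (auto simp: cgenideal_def)
    then have "p divides br p x \<otimes> a"
      using m_comm[of z p] p(1) by (auto intro: dividesI)
    then have "p divides br p x"
      using p a x br_closed[OF p(1) x] unfolding ring_prime_def prime_def by blast
    then show ?thesis by (auto simp: factor_def)
  qed
  then show ?thesis using p by (simp add: poisson_prime_def poisson_normal_def)
qed

text \<open>The set \<open>\<Sigma>\<close> of the overview, with the unit innermost and the primes
  attached one at a time, so that its closure properties follow by rule induction.\<close>

inductive poisson_factored :: "'a \<Rightarrow> bool" where
  unit: "u \<in> Units R \<Longrightarrow> poisson_factored u"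
| mult: "\<lbrakk>poisson_prime R br p; poisson_factored s\<rbrakk> \<Longrightarrow> poisson_factored (p \<otimes> s)"

lemma poisson_factored_closed: "poisson_factored s \<Longrightarrow> s \<in> carrier R"
  by (induction rule: poisson_factored.induct) (auto simp: poisson_prime_def)

lemma poisson_factored_finprod:
  assumes "poisson_factored s"
  shows "\<exists>u\<in>Units R. \<exists>m. \<exists>p :: nat \<Rightarrow> 'a. (\<forall>i\<in>{1..m}. poisson_prime R br (p i)) \<and>
    s = u \<otimes> (\<Otimes>i\<in>{1..m}. p i)"
  using assms
proof induction
  case (unit u)
  show ?case
  proof (intro bexI exI[of _ 0] exI conjI)
    show "u = u \<otimes> (\<Otimes>i\<in>{1..0::nat}. \<one>)" using unit by (simp add: Units_closed)
  qed (use unit in auto)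
next
  case (mult q s)
  then obtain u m p where u: "u \<in> Units R" and p: "\<forall>i\<in>{1..m}. poisson_prime R br (p i)"
    and s: "s = u \<otimes> (\<Otimes>i\<in>{1..m::nat}. p i)" by blast
  have q: "q \<in> carrier R" using mult by (simp add: poisson_prime_def)
  have pc: "p \<in> {1..m} \<rightarrow> carrier R" using p by (auto simp: poisson_prime_def)
  let ?p = "p(Suc m := q)"
  have "(\<Otimes>i\<in>{1..Suc m}. ?p i) = ?p (Suc m) \<otimes> (\<Otimes>i\<in>{1..m}. ?p i)"
  proof -
    have "{1..Suc m} = insert (Suc m) {1..m}" by auto
    then show ?thesis using q pc by (simp add: Pi_iff)
  qed
  also have "(\<Otimes>i\<in>{1..m}. ?p i) = (\<Otimes>i\<in>{1..m}. p i)"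
    using pc by (intro finprod_cong') auto
  finally have "q \<otimes> s = u \<otimes> (\<Otimes>i\<in>{1..Suc m}. ?p i)"
    using s q u pc by (simp add: m_lcomm Units_closed)
  moreover have "\<forall>i\<in>{1..Suc m}. poisson_prime R br (?p i)"
    using p mult by (auto simp: le_Suc_eq)
  ultimately show ?case using u by blast
qed

lemma poisson_factored_mult:
  assumes "poisson_factored s" "poisson_factored v"
  shows "poisson_factored (s \<otimes> v)"
  using assms(1)
proof induction
  case (unit u)
  \<comment> \<open>A second induction carries the unit \<open>u\<close> inwards to the unit of
    \<open>v\<close>.\<close>
  from assms(2) show ?case
  proof induction
    case (unit v)
    then show ?case using \<open>u \<in> Units R\<close> by (intro poisson_factored.unit) auto
  next
    case (mult p v)
    then have "poisson_factored (p \<otimes> (u \<otimes> v))" using poisson_factored.mult by blast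
    then show ?case
      using mult \<open>u \<in> Units R\<close> poisson_factored_closed
      by (simp add: poisson_prime_def m_lcomm Units_closed)
  qed
next
  case (mult p s)
  then have "poisson_factored (p \<otimes> (s \<otimes> v))" using poisson_factored.mult by blast
  then show ?case
    using mult assms(2) poisson_factored_closed by (simp add: poisson_prime_def m_assoc)
qed

lemma poisson_factored_pow: "poisson_factored s \<Longrightarrow> poisson_factored (s [^] (n::nat))"
  by (induction n) (auto intro: poisson_factored.unit poisson_factored_mult)

text \<open>Each prime of \<open>s\<close> divides \<open>a\<close> or \<open>b\<close>; cancel it
  there and continue with the rest. This keeps all multiples of an element outside
  \<open>\<Sigma>\<close> outside as well.\<close>

lemma poisson_factored_divisor:
  assumes "poisson_factored s" "s = a \<otimes> b" "a \<in> carrier R" "b \<in> carrier R"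
  shows "poisson_factored a"
  using assms
proof (induction arbitrary: a b)
  case (unit u)
  then have "a \<in> Units R" using unit_factor by blast
  then show ?case by (rule poisson_factored.unit)
next
  case (mult p s)
  have p: "p \<in> carrier R" "p \<noteq> \<zero>" "prime R p"
    using mult by (auto simp: poisson_prime_def ring_prime_def)
  have s: "s \<in> carrier R" using mult poisson_factored_closed by blast
  have "p divides a \<otimes> b" using s mult.prems(1) by (intro dividesI[of s]) auto
  then consider "p divides a" | "p divides b"
    using p(3) mult.prems(2,3) unfolding prime_def by blast
  then show ?case
  proof cases
    case 1
    then obtain a' where a': "a' \<in> carrier R" "a = p \<otimes> a'" by (auto simp: factor_def)
    then have "p \<otimes> s = p \<otimes> (a' \<otimes> b)" using mult p by (simp add: m_assoc)
    then have "s = a' \<otimes> b" using p s a' mult by (simp add: m_lcancel)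
    then have "poisson_factored a'" using mult a' by blast
    then show ?thesis using a' mult by (auto intro: poisson_factored.mult)
  next
    case 2
    then obtain b' where b': "b' \<in> carrier R" "b = p \<otimes> b'" by (auto simp: factor_def)
    then have "p \<otimes> s = p \<otimes> (a \<otimes> b')" using mult p by (simp add: m_lcomm)
    then have "s = a \<otimes> b'" using p s b' mult by (simp add: m_lcancel)
    then show ?thesis using mult b' by blast
  qed
qed

subsection \<open>Poisson ideals\<close>

definition poisson_ideal :: "'a set \<Rightarrow> bool" where
  "poisson_ideal I \<longleftrightarrow> ideal I R \<and> (\<forall>a\<in>I. \<forall>x\<in>carrier R. br a x \<in> I)"

text \<open>The exponent \<open>0\<close> is harmless for an ideal \<open>I\<close>: it contributes
  only if \<open>\<one> \<in> I\<close>, and then the radical is the whole ring anyway.\<close>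

definition radical :: "'a set \<Rightarrow> 'a set" where
  "radical I = {a \<in> carrier R. \<exists>n::nat. a [^] n \<in> I}"

definition colon :: "'a set \<Rightarrow> 'a \<Rightarrow> 'a set" where
  "colon I b = {a \<in> carrier R. a \<otimes> b \<in> I}"

lemma poisson_ideal_cgenideal:
  assumes "poisson_normal R br d"
  shows "poisson_ideal (PIdl d)"
proof -
  have d: "d \<in> carrier R" using assms by (simp add: poisson_normal_def)
  have "br (z \<otimes> d) x \<in> PIdl d" if zx: "z \<in> carrier R" "x \<in> carrier R" for z x
  proof -
    obtain w where w: "w \<in> carrier R" "br d x = d \<otimes> w"
      using assms zx by (auto simp: poisson_normal_def)
    have "br (z \<otimes> d) x = (br z x \<oplus> z \<otimes> w) \<otimes> d"
      using d zx w by (simp add: br_mult l_distr m_assoc m_comm[of d w])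
    then show ?thesis using d zx w by (auto simp: cgenideal_def)
  qed
  then show ?thesis
    using d cgenideal_ideal by (auto simp: poisson_ideal_def cgenideal_def)
qed

text \<open>The factor \<open>c\<close> replaces the binomial theorem: peel off one factor \<open>a \<oplus> b\<close> at a time.\<close>

lemma add_pow_mem_ideal:
  fixes n m :: nat
  assumes "ideal I R" "a \<in> carrier R" "b \<in> carrier R" "c \<in> carrier R"
    "c \<otimes> a [^] n \<in> I" "c \<otimes> b [^] m \<in> I"
  shows "c \<otimes> (a \<oplus> b) [^] (n + m) \<in> I"
  using assms
proof (induction "n + m" arbitrary: n m c)
  case 0
  then show ?case by simp
next
  case (Suc k)
  interpret ideal I R by (rule Suc)
  note carr = Suc.prems(2-4)
  show ?case
  proof (cases "n = 0 \<or> m = 0")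
    case True
    then have "c \<in> I"
    proof
      assume "n = 0" then show ?thesis using Suc.prems(5) carr by simp
    next
      assume "m = 0" then show ?thesis using Suc.prems(6) carr by simp
    qed
    then show ?thesis by (rule I_r_closed) (simp add: carr)
  next
    case False
    then obtain n' m' where nm: "n = Suc n'" "m = Suc m'" by (auto simp: gr0_conv_Suc)
    have k: "k = n' + m" "k = n + m'" using Suc.hyps(2) nm by auto
    have "c \<otimes> a \<otimes> (a \<oplus> b) [^] (n' + m) \<in> I"
    proof (rule Suc.hyps(1)[OF k(1) Suc.prems(1)])
      show "c \<otimes> a \<otimes> a [^] n' \<in> I" using Suc.prems(5) carr nm by (simp add: m_ac)
      have "a \<otimes> (c \<otimes> b [^] m) \<in> I" by (rule I_l_closed) (use Suc.prems(6) carr in auto)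
      then show "c \<otimes> a \<otimes> b [^] m \<in> I" using carr by (simp add: m_ac)
    qed (use carr in auto)
    moreover have "c \<otimes> b \<otimes> (a \<oplus> b) [^] (n + m') \<in> I"
    proof (rule Suc.hyps(1)[OF k(2) Suc.prems(1)])
      have "b \<otimes> (c \<otimes> a [^] n) \<in> I" by (rule I_l_closed) (use Suc.prems(5) carr in auto)
      then show "c \<otimes> b \<otimes> a [^] n \<in> I" using carr by (simp add: m_ac)
      show "c \<otimes> b \<otimes> b [^] m' \<in> I" using Suc.prems(6) carr nm by (simp add: m_ac)
    qed (use carr in auto)
    ultimately have "c \<otimes> a \<otimes> (a \<oplus> b) [^] k \<oplus> c \<otimes> b \<otimes> (a \<oplus> b) [^] k \<in> I"
      using k by simp
    moreover have "c \<otimes> (a \<oplus> b) [^] Suc k = c \<otimes> a \<otimes> (a \<oplus> b) [^] k \<oplus> c \<otimes> b \<otimes> (a \<oplus> b) [^] k"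
      using carr by (simp add: l_distr r_distr m_ac)
    ultimately show ?thesis using Suc.hyps(2) by simp
  qed
qed

lemma ideal_memI:
  assumes "I \<subseteq> carrier R" "\<zero> \<in> I" "\<And>a b. \<lbrakk>a \<in> I; b \<in> I\<rbrakk> \<Longrightarrow> a \<oplus> b \<in> I"
    "\<And>a x. \<lbrakk>a \<in> I; x \<in> carrier R\<rbrakk> \<Longrightarrow> x \<otimes> a \<in> I"
  shows "ideal I R"
proof (rule idealI)
  show "subgroup I (add_monoid R)"
  proof (rule add.subgroupI)
    fix a assume a: "a \<in> I"
    then have "\<ominus> \<one> \<otimes> a \<in> I" using assms by auto
    then show "\<ominus> a \<in> I" using a assms(1) by (auto simp: l_minus)
  qed (use assms in auto)
  show "a \<otimes> x \<in> I" if "a \<in> I" "x \<in> carrier R" for a x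
    using assms(4)[OF that] that assms(1) by (metis m_comm subsetD)
qed (use assms ring_axioms in auto)

lemma ideal_radical:
  assumes "ideal I R"
  shows "ideal (radical I) R"
proof (rule ideal_memI)
  interpret ideal I R by (rule assms)
  show "radical I \<subseteq> carrier R" by (auto simp: radical_def)
  show "\<zero> \<in> radical I" by (auto simp: radical_def intro!: exI[of _ 1])
  show "a \<oplus> b \<in> radical I" if ab: "a \<in> radical I" "b \<in> radical I" for a b
  proof -
    obtain n m :: nat where "a [^] n \<in> I" "b [^] m \<in> I" "a \<in> carrier R" "b \<in> carrier R"
      using ab by (auto simp: radical_def)
    then show ?thesis
      using add_pow_mem_ideal[OF assms, of a b \<one> n m] by (auto simp: radical_def)
  qed
  show "x \<otimes> a \<in> radical I" if ax: "a \<in> radical I" "x \<in> carrier R" for a x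
  proof -
    obtain n :: nat where n: "a \<in> carrier R" "a [^] n \<in> I" using ax by (auto simp: radical_def)
    then have "(x \<otimes> a) [^] n \<in> I" using ax I_l_closed by (simp add: nat_pow_distrib)
    then show ?thesis using n ax by (auto simp: radical_def)
  qed
qed

text \<open>Write \<open>b\<close> for \<open>br a x\<close>. Bracketing
  \<open>a [^] Suc m \<otimes> b [^] j\<close> with \<open>x\<close> and multiplying by
  \<open>b\<close> leaves, modulo \<open>I\<close>, a unit times
  \<open>a [^] m \<otimes> b [^] (j + 2)\<close>. Each factor \<open>a\<close> is thus traded for
  two factors \<open>b\<close>.\<close>

lemma br_pow_mem_poisson_ideal:
  fixes m j :: nat
  assumes I: "poisson_ideal I" and a: "a \<in> carrier R" and x: "x \<in> carrier R"
    and mem: "a [^] m \<otimes> br a x [^] j \<in> I"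
  shows "br a x [^] (j + 2 * m) \<in> I"
  using mem
proof (induction m arbitrary: j)
  case 0
  then show ?case using a x by simp
next
  case (Suc m)
  interpret ideal I R using I by (simp add: poisson_ideal_def)
  define b where "b = br a x"
  let ?e = "[Suc m] \<cdot> \<one>"
  have b: "b \<in> carrier R" using a x by (simp add: b_def)
  have e: "?e \<in> Units R" "?e \<in> carrier R" using nat_unit[of "Suc m"] by auto
  have mem: "a [^] Suc m \<otimes> b [^] j \<in> I" using Suc.prems by (simp add: b_def)
  obtain c where c: "c \<in> carrier R" "br (b [^] j) x \<otimes> b = b [^] j \<otimes> c"
    using br_pow_mult[OF b x] by blast
  have "br (a [^] Suc m \<otimes> b [^] j) x \<in> I"
    using I mem x by (simp add: poisson_ideal_def)
  then have "br (a [^] Suc m \<otimes> b [^] j) x \<otimes> b \<in> I" using b by (intro I_r_closed)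
  moreover have "br (a [^] Suc m \<otimes> b [^] j) x \<otimes> b =
      ?e \<otimes> (a [^] m \<otimes> b [^] (j + 2)) \<oplus> a [^] Suc m \<otimes> b [^] j \<otimes> c"
  proof -
    have "br (a [^] Suc m \<otimes> b [^] j) x \<otimes> b =
        br (a [^] Suc m) x \<otimes> b [^] j \<otimes> b \<oplus> a [^] Suc m \<otimes> (br (b [^] j) x \<otimes> b)"
      using a b x by (simp add: br_mult l_distr r_distr m_assoc a_assoc del: nat_pow_Suc)
    also have "br (a [^] Suc m) x \<otimes> b [^] j \<otimes> b = ?e \<otimes> (a [^] m \<otimes> b [^] (j + 2))"
      unfolding br_pow_Suc[OF a x] b_def[symmetric]
      using a b e(2) by (simp add: numeral_2_eq_2 m_ac del: add.nat_pow_Suc)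
    also have "a [^] Suc m \<otimes> (br (b [^] j) x \<otimes> b) = a [^] Suc m \<otimes> b [^] j \<otimes> c"
      unfolding c(2) using a b c(1) by (simp add: m_assoc del: nat_pow_Suc)
    finally show ?thesis .
  qed
  moreover have "a [^] Suc m \<otimes> b [^] j \<otimes> c \<in> I" using mem c(1) by (rule I_r_closed)
  ultimately have "?e \<otimes> (a [^] m \<otimes> b [^] (j + 2)) \<in> I"
    using a b c(1) e(2) add_mem_cancel[of "?e \<otimes> (a [^] m \<otimes> b [^] (j + 2))"] by simp
  then have "a [^] m \<otimes> b [^] (j + 2) \<in> I"
    by (rule unit_mult_mem_ideal[OF is_ideal, rotated 2]) (use a b e(1) in auto)
  then show ?case using Suc.IH[of "j + 2"] by (simp add: b_def)
qed

lemma poisson_ideal_radical: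
  assumes "poisson_ideal I"
  shows "poisson_ideal (radical I)"
proof -
  have "br a x \<in> radical I" if ax: "a \<in> radical I" "x \<in> carrier R" for a x
  proof -
    obtain n :: nat where n: "a \<in> carrier R" "a [^] n \<in> I" using ax by (auto simp: radical_def)
    then have "br a x [^] (0 + 2 * n) \<in> I"
      using assms ax by (intro br_pow_mem_poisson_ideal[of I a x n 0]) auto
    then show ?thesis using n ax by (auto simp: radical_def)
  qed
  then show ?thesis using assms ideal_radical by (auto simp: poisson_ideal_def)
qed

text \<open>For \<open>a\<close> in the colon ideal put \<open>v = br a x \<otimes> b\<close>.
  Multiplying \<open>br (a \<otimes> b) x\<close> by \<open>v\<close> gives the square of
  \<open>v\<close> plus a multiple of \<open>a \<otimes> b\<close>; so the square lies in
  \<open>I\<close>, and \<open>v\<close> does because \<open>I\<close> is radical.\<close>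

lemma poisson_ideal_colon:
  assumes I: "poisson_ideal I" and rad: "radical I = I" and b: "b \<in> carrier R"
  shows "poisson_ideal (colon I b)"
proof -
  interpret ideal I R using I by (simp add: poisson_ideal_def)
  have "ideal (colon I b) R"
  proof (rule ideal_memI)
    show "\<zero> \<in> colon I b" using b by (simp add: colon_def)
    show "x \<oplus> z \<in> colon I b" if "x \<in> colon I b" "z \<in> colon I b" for x z
      using that b by (simp add: colon_def l_distr)
    show "z \<otimes> x \<in> colon I b" if "x \<in> colon I b" "z \<in> carrier R" for x z
      using that b by (simp add: colon_def m_assoc I_l_closed)
  qed (auto simp: colon_def)
  moreover have "br a x \<in> colon I b" if "a \<in> colon I b" and x: "x \<in> carrier R" for a x
  proof -
    have a: "a \<in> carrier R" "a \<otimes> b \<in> I" using that by (auto simp: colon_def)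
    let ?v = "br a x \<otimes> b"
    have "br (a \<otimes> b) x \<otimes> ?v \<in> I"
      by (rule I_r_closed) (use I a x b in \<open>auto simp: poisson_ideal_def\<close>)
    moreover have "br (a \<otimes> b) x \<otimes> ?v = ?v \<otimes> ?v \<oplus> a \<otimes> b \<otimes> (br b x \<otimes> br a x)"
      using a x b by (simp add: br_mult l_distr r_distr m_ac)
    moreover have "a \<otimes> b \<otimes> (br b x \<otimes> br a x) \<in> I"
      by (rule I_r_closed) (use a x b in auto)
    ultimately have "?v \<otimes> ?v \<in> I"
      using add_mem_cancel[of "?v \<otimes> ?v"] a(1) x b by simp
    then have "?v [^] (2::nat) \<in> I" using a x b by (simp add: numeral_2_eq_2)
    then have "?v \<in> radical I" unfolding radical_def using a(1) x b by auto
    then show ?thesis using rad a x by (simp add: colon_def)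
  qed
  ultimately show ?thesis by (simp add: poisson_ideal_def)
qed

section \<open>Factorization in noetherian Poisson factorial and in factorial domains\<close>

lemma poisson_factored_noetherian:
  assumes noeth: "noetherian_ring R"
    and ufd: "\<And>P. \<lbrakk>poisson_prime_ideal R br P; P \<noteq> {\<zero>}\<rbrakk> \<Longrightarrow> \<exists>p\<in>P. poisson_prime R br p"
    and d: "poisson_normal R br d" "d \<noteq> \<zero>"
  shows "poisson_factored d"
proof (rule ccontr)
  assume not: "\<not> poisson_factored d"
  have d_closed: "d \<in> carrier R" using d by (simp add: poisson_normal_def)
  define F where "F = {I. poisson_ideal I \<and> d \<in> I \<and> (\<forall>s\<in>I. \<not> poisson_factored s)}"
  have "\<not> poisson_factored (z \<otimes> d)" if "z \<in> carrier R" for z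
    using poisson_factored_divisor[OF _ m_comm[OF that d_closed] d_closed that] not by blast
  then have "PIdl d \<in> F"
    using poisson_ideal_cgenideal[OF d(1)] cgenideal_self[OF d_closed]
    unfolding F_def by (auto simp: cgenideal_def)
  then have "F \<noteq> {}" by auto
  \<comment> \<open>In a noetherian ring a nonempty chain of ideals contains its union, which
    supplies the upper bounds for Zorn's lemma.\<close>
  moreover have "\<Union>K \<in> F" if K: "K \<noteq> {}" "subset.chain F K" for K
  proof -
    have "subset.chain {I. ideal I R} K"
      using K(2) by (auto simp: subset.chain_def F_def poisson_ideal_def)
    then have "\<Union>K \<in> K" using noetherian_ring.ideal_chain_is_trivial[OF noeth K(1)] by simp
    then show ?thesis using K(2) by (auto simp: subset.chain_def)
  qed
  ultimately obtain P where P: "P \<in> F" and max: "\<And>I. \<lbrakk>I \<in> F; P \<subseteq> I\<rbrakk> \<Longrightarrow> I = P"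
    using subset_Zorn_nonempty[of F] by blast
  have PI: "poisson_ideal P" and dP: "d \<in> P" and Pnot: "\<And>s. s \<in> P \<Longrightarrow> \<not> poisson_factored s"
    using P by (auto simp: F_def)
  interpret ideal P R using PI by (simp add: poisson_ideal_def)
  have "P \<subseteq> radical P"
    using Icarr by (auto simp: radical_def intro!: exI[of _ "1::nat"])
  \<comment> \<open>\<open>\<Sigma>\<close> is closed under powers: an element of it in the radical
    would have a power in \<open>P\<close> that is still in \<open>\<Sigma>\<close>.\<close>
  moreover from this have "radical P \<in> F"
    using poisson_ideal_radical[OF PI] dP Pnot poisson_factored_pow
    by (auto simp: F_def) (auto simp: radical_def)
  ultimately have rad: "radical P = P" using max by simp
  have colon_subset: "P \<subseteq> colon P b" if "b \<in> carrier R" for b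
    using that Icarr I_r_closed by (auto simp: colon_def)
  have colon_eq: "colon P b = P"
    if b: "b \<in> carrier R" and "\<And>s. s \<in> colon P b \<Longrightarrow> \<not> poisson_factored s" for b
    using that colon_subset[OF b] dP poisson_ideal_colon[OF PI rad b] by (intro max) (auto simp: F_def)
  have "primeideal P R"
  proof (rule primeidealI)
    show "ideal P R" by (rule is_ideal)
    show "cring R" by (rule is_cring)
    show "carrier R \<noteq> P" using Pnot[of \<one>] poisson_factored.unit by auto
    fix a b assume a: "a \<in> carrier R" and b: "b \<in> carrier R" and ab: "a \<otimes> b \<in> P"
    show "a \<in> P \<or> b \<in> P"
    proof (rule disjCI)
      assume "b \<notin> P"
      \<comment> \<open>Suppose \<open>s\<close> in \<open>\<Sigma>\<close> lies in
        \<open>colon P b\<close>. Then \<open>b\<close> lies in \<open>colon P s\<close>, which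
        avoids \<open>\<Sigma>\<close> because \<open>\<Sigma>\<close> is multiplicative, and so
        equals \<open>P\<close> by maximality, against \<open>b \<notin> P\<close>. Hence
        \<open>colon P b\<close> avoids \<open>\<Sigma>\<close> and equals \<open>P\<close>, and it
        contains \<open>a\<close>.\<close>
      have "\<not> poisson_factored s" if s: "s \<in> colon P b" for s
      proof
        assume fs: "poisson_factored s"
        have s': "s \<in> carrier R" "s \<otimes> b \<in> P" using s by (auto simp: colon_def)
        have "colon P s = P"
        proof (rule colon_eq[OF s'(1)])
          fix v assume "v \<in> colon P s"
          then have "v \<otimes> s \<in> P" by (simp add: colon_def)
          then show "\<not> poisson_factored v" using Pnot fs poisson_factored_mult by blast
        qed
        then show False using \<open>b \<notin> P\<close> s' b by (auto simp: colon_def m_comm)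
      qed
      then have "colon P b = P" by (rule colon_eq[OF b])
      then show "a \<in> P" using a ab by (auto simp: colon_def)
    qed
  qed
  then have "poisson_prime_ideal R br P"
    using PI by (simp add: poisson_prime_ideal_def poisson_ideal_def)
  moreover have "P \<noteq> {\<zero>}" using dP d(2) by auto
  ultimately obtain p where p: "p \<in> P" "poisson_prime R br p" using ufd by blast
  then have "poisson_factored (p \<otimes> \<one>)"
    by (intro poisson_factored.mult poisson_factored.unit) auto
  then show False using Pnot[OF p(1)] p(2) by (simp add: poisson_prime_def)
qed

text \<open>Any prime factor \<open>p\<close> of \<open>d\<close> is Poisson prime, and the cofactor
  is again Poisson normal, so one prime is split off at a time.\<close>

lemma poisson_factored_factorial:
  assumes fact: "factorial_domain R"
    and d: "poisson_normal R br d" "d \<noteq> \<zero>"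
  shows "poisson_factored d"
proof -
  interpret factorial_domain R by (rule fact)
  let ?M = "mult_of R"
  \<comment> \<open>Proper divisibility among nonzero elements is well-founded. It drives both the
    extraction of the exact power of a prime and the induction on \<open>d\<close>.\<close>
  have wf: "wf {(x, y). x \<in> carrier ?M \<and> y \<in> carrier ?M \<and> properfactor ?M x y}"
    using factorial_condition_two[THEN iffD2, OF factorial_monoid_axioms]
    by (intro divisor_chain_condition_monoid.division_wellfounded) (rule conjunct1)
  have cofactor: "properfactor ?M b (p \<otimes> b)" "b \<noteq> \<zero>"
    if "p \<in> carrier R" "prime R p" "b \<in> carrier R" "p \<otimes> b \<noteq> \<zero>" for p b
  proof -
    show b: "b \<noteq> \<zero>" using that by auto
    have p: "p \<noteq> \<zero>" using that by auto
    have "p \<notin> Units ?M" using that(2) prime_not_unit by simp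
    moreover have "p \<otimes> b = b \<otimes> p" using that by (intro m_comm)
    ultimately show "properfactor ?M b (p \<otimes> b)"
      using that p b mult_of.properfactorI3[of "p \<otimes> b" b p] by simp
  qed
  have mult: "\<exists>n::nat. \<exists>a\<in>carrier R. c = p [^] n \<otimes> a \<and> \<not> p divides a"
    if p: "p \<in> carrier R" "prime R p" and "c \<in> carrier R" "c \<noteq> \<zero>" for p c
    using that(3,4)
  proof (induction c rule: wf_induct_rule[OF wf])
    case (1 c)
    show ?case
    proof (cases "p divides c")
      case True
      then obtain b where b: "b \<in> carrier R" "c = p \<otimes> b" by (auto simp: factor_def)
      have nz: "p \<otimes> b \<noteq> \<zero>" using 1 b by simp
      have "(b, c) \<in> {(x, y). x \<in> carrier ?M \<and> y \<in> carrier ?M \<and> properfactor ?M x y}"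
        using cofactor[OF p b(1) nz] 1 b by simp
      from "1.IH"[OF this b(1) cofactor(2)[OF p b(1) nz]]
      obtain n :: nat and a where a: "a \<in> carrier R" "b = p [^] n \<otimes> a" "\<not> p divides a"
        by blast
      have "c = p [^] Suc n \<otimes> a" unfolding b(2) a(2)
        using p(1) a(1) by (simp only: nat_pow_Suc2 m_assoc nat_pow_closed)
      then show ?thesis using a by blast
    next
      case False
      then show ?thesis using 1 by (intro exI[of _ "0::nat"] bexI[of _ c]) auto
    qed
  qed
  have "d \<in> carrier R" using d by (simp add: poisson_normal_def)
  then show ?thesis using d
  proof (induction d rule: wf_induct_rule[OF wf])
    case (1 d)
    show ?case
    proof (cases "d \<in> Units R")
      case True
      then show ?thesis by (rule poisson_factored.unit)
    next
      case False
      then have nonunit: "d \<notin> Units ?M" by simp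
      obtain fs where fs: "set fs \<subseteq> carrier ?M" "factors ?M fs d"
        using factorial_monoid.factors_exist[OF factorial_monoid_axioms, of d] nonunit "1.prems" by auto
      obtain p ps where fs_eq: "fs = p # ps"
        using fs(2) mult_of.Units_one_closed nonunit by (cases fs) (auto simp: factors_def)
      define b where "b = foldr (\<otimes>) ps \<one>"
      have p: "p \<in> carrier R" "p \<noteq> \<zero>" "irreducible ?M p" and d_eq: "d = p \<otimes> b"
        and ps: "set ps \<subseteq> carrier R"
        using fs by (auto simp: factors_def fs_eq b_def)
      have "prime ?M p" using p by (intro factorial_monoid.irreducible_prime[OF factorial_monoid_axioms]) auto
      then have prime: "ring_prime p" "prime R p"
        using p ring_primeI'[of p] by (auto simp: ring_prime_def)
      have b: "b \<in> carrier R" unfolding b_def using ps by (induction ps) auto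
      obtain n :: nat and a where a: "a \<in> carrier R" "d = p [^] n \<otimes> a" "\<not> p divides a"
        using mult[OF p(1) prime(2)] "1.prems" by blast
      \<comment> \<open>\<open>p\<close> divides \<open>d\<close>, so its exact exponent is
        positive, as \<open>prime_factor_poisson_normal\<close> demands.\<close>
      have "n \<noteq> 0"
      proof
        assume "n = 0"
        then have "a = p \<otimes> b" using a(1,2) d_eq by simp
        then show False using a(3) b by (auto simp: factor_def)
      qed
      then obtain n' where "n = Suc n'" by (auto simp: gr0_conv_Suc)
      then have "poisson_normal R br (p [^] Suc n' \<otimes> a)" using a(2) "1.prems"(2) by simp
      then have pp: "poisson_prime R br p"
        by (rule prime_factor_poisson_normal[OF p(1) prime(1) a(1,3)])
      have nz: "p \<otimes> b \<noteq> \<zero>" using "1.prems"(3) d_eq by simp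
      have "poisson_normal R br b"
        using pp b by (rule poisson_normal_cofactor) (use "1.prems"(2) d_eq in simp)
      moreover have "(b, d) \<in> {(x, y). x \<in> carrier ?M \<and> y \<in> carrier ?M \<and> properfactor ?M x y}"
        using cofactor[OF p(1) prime(2) b nz] "1.prems" b by (simp add: d_eq)
      ultimately have "poisson_factored b"
        using b cofactor(2)[OF p(1) prime(2) b nz] by (intro "1.IH")
      then show ?thesis unfolding d_eq using pp by (intro poisson_factored.mult)
    qed
  qed
qed

end


section \<open>Discriminants of specializations\<close>

lemma laurent_const_hom:
  "laurent_const (c + c') = laurent_const c + laurent_const c'"
  "laurent_const (c * c') = laurent_const c * laurent_const c'"
  "laurent_const 1 = 1"
  by (simp_all add: laurent_const_def single_add mult_single)

text \<open>Interpreted twice below: for the specialization, where the scalar \<open>- 1\<close>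
  yields negation, and for \<open>C\<close>, where the positive integers become units.\<close>

locale ring_with_scalars = ring +
  fixes k :: "'k::field_char_0 \<Rightarrow> 'a"
  assumes k_closed [simp]: "k c \<in> carrier R"
    and k_add: "k (c + c') = k c \<oplus> k c'"
    and k_mult: "k (c * c') = k c \<otimes> k c'"
    and k_one: "k 1 = \<one>"
begin

lemma k_zero: "k 0 = \<zero>"
  using k_add[of 0 0] by (metis add.l_cancel_one' add_0 k_closed r_zero zero_closed)

lemma k_minus_one: "k (- 1) = \<ominus> \<one>"
  using k_add[of "- 1" 1] by (simp add: k_zero k_one minus_equality)

lemma k_of_nat: "k (of_nat n) = [n] \<cdot> \<one>"
  by (induction n) (simp_all add: k_zero k_add k_one a_comm)

lemma of_nat_Units:
  assumes "0 < (n::nat)"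
  shows "[n] \<cdot> \<one> \<in> Units R"
proof -
  have "k (of_nat n) \<otimes> k (inverse (of_nat n)) = \<one>" "k (inverse (of_nat n)) \<otimes> k (of_nat n) = \<one>"
    using assms by (simp_all add: k_mult[symmetric] k_one)
  then have "k (of_nat n) \<in> Units R" unfolding Units_def using k_closed by blast
  then show ?thesis by (simp add: k_of_nat)
qed

end

theorem theoremA:
  fixes R :: "('r, 'm) ring_scheme"
    and h :: "('k::field_char_0) laurent \<Rightarrow> 'r"
    and \<epsilon> :: 'k
    and t :: 'r
    and C :: "'r set set"
    and N :: nat
    and y :: "nat \<Rightarrow> 'r set"
  assumes "algebra_over h R"
    and "\<epsilon> \<noteq> 0"
    and "t = h (laurent_q - laurent_const \<epsilon>)"
    and "regular_element R t"
    and "poisson_subalgebra (spec_center R t) (\<lambda>c. spec_map R t (h (laurent_const c)))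
           (spec_bracket R t) C"
    and "module_basis (specialization R t) C N y"
  shows "let A = (specialization R t)\<lparr>carrier := C\<rparr>;
             k = (\<lambda>c. spec_map R t (h (laurent_const c)));
             br = spec_bracket R t;
             d = discriminant (specialization R t) C N y
         in poisson_normal A br d \<and>
            (factorial_domain A \<or> noetherian_poisson_ufd A k br \<longrightarrow>
               d = \<zero>\<^bsub>A\<^esub> \<or>
               (\<exists>u \<in> Units A. \<exists>m. \<exists>p :: nat \<Rightarrow> 'r set.
                  (\<forall>i \<in> {1..m}. poisson_prime A br (p i)) \<and>
                  d = u \<otimes>\<^bsub>A\<^esub> (\<Otimes>\<^bsub>A\<^esub>i\<in>{1..m}. p i)))"
proof -
  have R: "ring R" and h: "h \<in> ring_hom ring_of_type_algebra R" and h_central: "range h \<subseteq> ring_center R"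
    using assms(1) by (auto simp: algebra_over_def)
  interpret ring R by (rule R)
  interpret central_regular_element R t
  proof
    fix x assume "x \<in> carrier R"
    moreover have "t \<in> ring_center R" using h_central assms(3) by auto
    ultimately show "x \<otimes>\<^bsub>R\<^esub> t = t \<otimes>\<^bsub>R\<^esub> x" by (simp add: ring_center_def)
  qed (rule assms(4))
  let ?k = "\<lambda>c. spec_map R t (h (laurent_const c))"
  let ?br = "spec_bracket R t"
  let ?A = "S\<lparr>carrier := C\<rparr>"
  let ?d = "discriminant S C N y"
  interpret S: ring S by (rule ring_S)
  interpret S: ring_with_scalars S ?k
  proof
    have h_closed: "h a \<in> carrier R" for a
      using ring_hom_closed[OF h] by (simp add: ring_of_type_algebra_def)
    show "?k c \<in> carrier S" for c by (simp add: h_closed)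
    show "?k (c + c') = ?k c \<oplus>\<^bsub>S\<^esub> ?k c'" for c c'
      using ring_hom_add[OF h] ring_hom_add[OF proj_hom] h_closed
      by (simp add: ring_of_type_algebra_def laurent_const_hom)
    show "?k (c * c') = ?k c \<otimes>\<^bsub>S\<^esub> ?k c'" for c c'
      using ring_hom_mult[OF h] ring_hom_mult[OF proj_hom] h_closed
      by (simp add: ring_of_type_algebra_def laurent_const_hom)
    show "?k 1 = \<one>\<^bsub>S\<^esub>"
      using ring_hom_one[OF h] ring_hom_one[OF proj_hom]
      by (simp add: ring_of_type_algebra_def laurent_const_hom)
  qed
  have sub: "subring C (spec_center R t)"
    and scale: "\<And>c x. x \<in> C \<Longrightarrow> ?k c \<otimes>\<^bsub>S\<^esub> x \<in> C"
    and br_C: "\<And>x z. \<lbrakk>x \<in> C; z \<in> C\<rbrakk> \<Longrightarrow> ?br x z \<in> C"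
    using assms(5) by (auto simp: poisson_subalgebra_def spec_center_def)
  have C_center: "C \<subseteq> ring_center S" and C_one: "\<one>\<^bsub>S\<^esub> \<in> C"
    and C_mult: "\<And>x z. \<lbrakk>x \<in> C; z \<in> C\<rbrakk> \<Longrightarrow> x \<otimes>\<^bsub>S\<^esub> z \<in> C"
    and C_add: "\<And>x z. \<lbrakk>x \<in> C; z \<in> C\<rbrakk> \<Longrightarrow> x \<oplus>\<^bsub>S\<^esub> z \<in> C"
    using subringE[OF sub] by (auto simp: spec_center_def)
  have C_carrier: "C \<subseteq> carrier S" using C_center by (auto simp: ring_center_def)
  have subring: "subring C S"
  proof (rule S.subringI[OF C_carrier C_one _ C_mult C_add])
    fix x assume x: "x \<in> C"
    \<comment> \<open>Negation depends on the carrier of the record, and \<open>C\<close> is given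
      as a subring of the center; closure under the negation of \<open>S\<close> is obtained from
      the scalar \<open>- 1\<close>.\<close>
    then have "?k (- 1) \<otimes>\<^bsub>S\<^esub> x = \<ominus>\<^bsub>S\<^esub> x"
      unfolding S.k_minus_one using C_carrier by (auto simp: S.l_minus)
    then show "\<ominus>\<^bsub>S\<^esub> x \<in> C" using scale[OF x, of "- 1"] by simp
  qed
  interpret free_central_algebra S C N y
  proof (intro free_central_algebra.intro free_central_algebra_axioms.intro)
    show "c \<otimes>\<^bsub>S\<^esub> s = s \<otimes>\<^bsub>S\<^esub> c" if "c \<in> C" "s \<in> carrier S" for c s
      using that C_center by (auto simp: ring_center_def)
  qed (simp_all add: S.ring_axioms subring assms(6))
  \<comment> \<open>Centrality of \<open>x\<close> provides the derivation of all of
    \<open>S\<close>; being a Poisson subalgebra makes \<open>C\<close> stable under it.\<close>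
  have deriv: "free_central_algebra_derivation S C N y (\<lambda>s. ?br s x)" if "x \<in> C" for x
  proof -
    interpret ring_derivation S "\<lambda>s. ?br s x"
      using that C_center by (intro spec_bracket_derivation) auto
    show ?thesis by unfold_locales (use that br_C in auto)
  qed
  \<comment> \<open>\<open>discriminant_D\<close> lives in a context with a derivation; the bracket
    with \<open>\<one>\<close> serves as an instance.\<close>
  have d_closed: "?d \<in> C"
    using free_central_algebra_derivation.discriminant_D(1)[OF deriv[OF C_one]] .
  have normal: "poisson_normal ?A ?br ?d"
    unfolding poisson_normal_def
    using d_closed free_central_algebra_derivation.discriminant_D(2)[OF deriv] by simp
  have factored: "\<exists>u\<in>Units ?A. \<exists>m. \<exists>p :: nat \<Rightarrow> 'r set. (\<forall>i\<in>{1..m}. poisson_prime ?A ?br (p i)) \<and>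
      ?d = u \<otimes>\<^bsub>?A\<^esub> (\<Otimes>\<^bsub>?A\<^esub>i\<in>{1..m}. p i)"
    if ufd: "factorial_domain ?A \<or> noetherian_poisson_ufd ?A ?k ?br" and nz: "?d \<noteq> \<zero>\<^bsub>?A\<^esub>"
  proof -
    have "domain ?A"
      using ufd by (auto simp: noetherian_poisson_ufd_def factorial_domain_def noetherian_domain_def)
    then interpret A: domain ?A .
    interpret A: ring_with_scalars ?A ?k
    proof
      \<comment> \<open>\<open>C\<close> contains \<open>\<one>\<close> and is closed under scaling,
        hence contains all scalars.\<close>
      show "?k c \<in> carrier ?A" for c
        using scale[OF C_one, of c] by simp
    qed (simp_all add: S.k_add S.k_mult S.k_one)
    interpret A: bracket_domain ?A ?br
    proof (intro bracket_domain.intro bracket_domain_axioms.intro)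
      show "domain ?A" by fact
    next
      fix x assume "x \<in> carrier ?A"
      then interpret D: free_central_algebra_derivation S C N y "\<lambda>s. ?br s x"
        using deriv by simp
      show "ring_derivation ?A (\<lambda>a. ?br a x)"
        by unfold_locales (auto simp: D.D_C D.D_add D.D_mult)
    qed (rule A.of_nat_Units)
    have "A.poisson_factored ?d"
      using ufd
    proof
      assume "factorial_domain ?A"
      then show ?thesis using normal nz by (rule A.poisson_factored_factorial)
    next
      assume "noetherian_poisson_ufd ?A ?k ?br"
      then show ?thesis using normal nz
        by (intro A.poisson_factored_noetherian)
          (auto simp: noetherian_poisson_ufd_def noetherian_domain_def)
    qed
    then show ?thesis by (rule A.poisson_factored_finprod)
  qed
  show ?thesis unfolding Let_def using normal factored by blast
qed

end
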